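(* Let $X$ be a cell complex with oriented cells $e_\alpha$ such that the closure $\overline e_\alpha$ of each cell has the rational homology of a point. Let $L=L(X)$ be the free graded Lie algebra over $\mathbb Q$ generated by the $e_\alpha$, with $e_\alpha$ in degree $\dim e_\alpha-1$, and write $L=L_0\oplus L_1\oplus L_2\oplus\cdots$ by bracket length ($L_1$ spanned by the generators, $L_k$ by $k$-fold brackets). Let $\delta_1$ be the derivation of $L$ extending the cellular boundary operator $L_1\to L_1$ (degree $-1$), and let $\delta_2$ be the derivation of $L$ extending a local linear map $L_1\to L_2$ of degree $-1$ coming from a local cellular approximation to the diagonal, such that $[\delta_1,\delta_2]=0$. Then there exist local linear maps $\delta_k:L_1\to L_k$ of degree $-1$, $k\ge3$, such that, extending each to a derivation of $L$, the total derivation $\delta=\delta_1+\delta_2+\delta_3+\cdots$ satisfies $\delta\circ\delta=0$.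
   Context: A map $L_1\to L_k$ is local if it sends each generator $e_\alpha$ into the sub-Lie-algebra generated by the cells in the closure of $e_\alpha$. $[\cdot,\cdot]$ denotes the graded commutator of derivations; $\delta\circ\delta=\tfrac12[\delta,\delta]$ for odd $\delta$. *)

theory Defs
  imports Complex_Main
begin

text \<open>Cells are the elements of the type 'c. cdim e is the dimension of e,
  ccl e the set of cells in the closure of e, and cbd e f the incidence number
  of f in the cellular boundary of the (oriented) cell e.\<close>

definition cell_complex ::
  "('c \<Rightarrow> nat) \<Rightarrow> ('c \<Rightarrow> 'c set) \<Rightarrow> ('c \<Rightarrow> 'c \<Rightarrow> int) \<Rightarrow> bool" where
  "cell_complex cdim ccl cbd \<longleftrightarrow>
     (\<forall>e. finite (ccl e) \<and> e \<in> ccl e) \<and>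
     (\<forall>e. \<forall>f\<in>ccl e. ccl f \<subseteq> ccl e) \<and>
     (\<forall>e. \<forall>f\<in>ccl e. f \<noteq> e \<longrightarrow> cdim f < cdim e) \<and>
     (\<forall>e f. cbd e f \<noteq> 0 \<longrightarrow> f \<in> ccl e \<and> cdim f + 1 = cdim e) \<and>
     (\<forall>e g. (\<Sum>f\<in>ccl e. cbd e f * cbd f g) = 0)"

definition chain_on :: "('c \<Rightarrow> nat) \<Rightarrow> 'c set \<Rightarrow> nat \<Rightarrow> ('c \<Rightarrow> rat) \<Rightarrow> bool" where
  "chain_on cdim S n c \<longleftrightarrow> (\<forall>f. c f \<noteq> 0 \<longrightarrow> f \<in> S \<and> cdim f = n)"

definition chain_bd :: "('c \<Rightarrow> 'c \<Rightarrow> int) \<Rightarrow> 'c set \<Rightarrow> ('c \<Rightarrow> rat) \<Rightarrow> ('c \<Rightarrow> rat)" where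
  "chain_bd cbd S c = (\<lambda>g. \<Sum>f\<in>S. c f * of_int (cbd f g))"

definition rat_homology_point ::
  "('c \<Rightarrow> nat) \<Rightarrow> ('c \<Rightarrow> 'c \<Rightarrow> int) \<Rightarrow> 'c set \<Rightarrow> bool" where
  "rat_homology_point cdim cbd S \<longleftrightarrow>
     (\<forall>n\<ge>1. \<forall>z. chain_on cdim S n z \<and> chain_bd cbd S z = (\<lambda>_. 0) \<longrightarrow>
        (\<exists>w. chain_on cdim S (n+1) w \<and> chain_bd cbd S w = z)) \<and>
     (\<exists>z0. chain_on cdim S 0 z0 \<and>
        \<not> (\<exists>w. chain_on cdim S 1 w \<and> chain_bd cbd S w = z0) \<and>
        (\<forall>z. chain_on cdim S 0 z \<longrightarrow>
           (\<exists>q w. chain_on cdim S 1 w \<and> z = (\<lambda>f. q * z0 f + chain_bd cbd S w f))))"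

text \<open>Elements of the tensor algebra T(V) over Q on the cells are coefficient
  functions on words of cells. The generator e has degree dim e - 1.\<close>

type_synonym 'c tens = "'c list \<Rightarrow> rat"

definition wdeg :: "('c \<Rightarrow> nat) \<Rightarrow> 'c list \<Rightarrow> int" where
  "wdeg cdim w = (\<Sum>e\<leftarrow>w. int (cdim e) - 1)"

definition sgn_of :: "int \<Rightarrow> rat" where
  "sgn_of k = (if even k then 1 else -1)"

definition gen :: "'c \<Rightarrow> 'c tens" where
  "gen e = (\<lambda>w. if w = [e] then 1 else 0)"

definition tadd :: "'c tens \<Rightarrow> 'c tens \<Rightarrow> 'c tens" where
  "tadd a b = (\<lambda>w. a w + b w)"

definition tsmult :: "rat \<Rightarrow> 'c tens \<Rightarrow> 'c tens" where
  "tsmult q a = (\<lambda>w. q * a w)"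

text \<open>Graded commutator [a,b] = ab - (-1)^{|a||b|} ba, extended bilinearly
  over the homogeneous (word) components.\<close>

definition lie :: "('c \<Rightarrow> nat) \<Rightarrow> 'c tens \<Rightarrow> 'c tens \<Rightarrow> 'c tens" where
  "lie cdim a b = (\<lambda>w. \<Sum>i\<le>length w.
      a (take i w) * b (drop i w)
      - sgn_of (wdeg cdim (take i w) * wdeg cdim (drop i w)) * b (take i w) * a (drop i w))"

text \<open>The sub-Lie-algebra generated by the cells in S (for S = UNIV this is the
  free graded Lie algebra L(X)).\<close>

inductive_set lie_gen :: "('c \<Rightarrow> nat) \<Rightarrow> 'c set \<Rightarrow> 'c tens set"
  for cdim :: "'c \<Rightarrow> nat" and S :: "'c set" where
  lg_gen: "e \<in> S \<Longrightarrow> gen e \<in> lie_gen cdim S"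
| lg_add: "a \<in> lie_gen cdim S \<Longrightarrow> b \<in> lie_gen cdim S \<Longrightarrow> tadd a b \<in> lie_gen cdim S"
| lg_smult: "a \<in> lie_gen cdim S \<Longrightarrow> tsmult q a \<in> lie_gen cdim S"
| lg_lie: "a \<in> lie_gen cdim S \<Longrightarrow> b \<in> lie_gen cdim S \<Longrightarrow> lie cdim a b \<in> lie_gen cdim S"

inductive lie_len :: "('c \<Rightarrow> nat) \<Rightarrow> 'c set \<Rightarrow> nat \<Rightarrow> 'c tens \<Rightarrow> bool"
  for cdim :: "'c \<Rightarrow> nat" and S :: "'c set" where
  ll_gen: "e \<in> S \<Longrightarrow> lie_len cdim S 1 (gen e)"
| ll_zero: "lie_len cdim S k (\<lambda>_. 0)"
| ll_add: "lie_len cdim S k a \<Longrightarrow> lie_len cdim S k b \<Longrightarrow> lie_len cdim S k (tadd a b)"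
| ll_smult: "lie_len cdim S k a \<Longrightarrow> lie_len cdim S k (tsmult q a)"
| ll_lie: "lie_len cdim S i a \<Longrightarrow> lie_len cdim S j b \<Longrightarrow> lie_len cdim S (i + j) (lie cdim a b)"

text \<open>Coefficient of w in the product p \<cdot> x \<cdot> s (p, s words, x a tensor).\<close>

definition ins :: "'c list \<Rightarrow> 'c tens \<Rightarrow> 'c list \<Rightarrow> 'c tens" where
  "ins p x s = (\<lambda>w. if length p + length s \<le> length w \<and> take (length p) w = p
        \<and> drop (length w - length s) w = s
      then x (drop (length p) (take (length w - length s) w)) else 0)"

text \<open>The odd derivation extending phi, applied to the word e_1 ... e_n:
  sum over i of (-1)^{|e_1 ... e_{i-1}|} e_1 ... e_{i-1} phi(e_i) e_{i+1} ... e_n.\<close>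

definition dword :: "('c \<Rightarrow> nat) \<Rightarrow> ('c \<Rightarrow> 'c tens) \<Rightarrow> 'c list \<Rightarrow> 'c tens" where
  "dword cdim phi u = (\<lambda>w. \<Sum>i<length u.
      sgn_of (wdeg cdim (take i u)) * ins (take i u) (phi (u ! i)) (drop (Suc i) u) w)"

text \<open>The derivation extending phi, applied to a finitely supported tensor
  (all elements of L are finitely supported).\<close>

definition der :: "('c \<Rightarrow> nat) \<Rightarrow> ('c \<Rightarrow> 'c tens) \<Rightarrow> 'c tens \<Rightarrow> 'c tens" where
  "der cdim phi a = (\<lambda>w. \<Sum>u\<in>{u. a u \<noteq> 0}. a u * dword cdim phi u w)"

definition cell_delta :: "('c \<Rightarrow> 'c set) \<Rightarrow> ('c \<Rightarrow> 'c \<Rightarrow> int) \<Rightarrow> 'c \<Rightarrow> 'c tens" where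
  "cell_delta ccl cbd e = (\<lambda>w. \<Sum>f\<in>ccl e. of_int (cbd e f) * gen f w)"

definition local_deg_minus1 ::
  "('c \<Rightarrow> nat) \<Rightarrow> ('c \<Rightarrow> 'c set) \<Rightarrow> nat \<Rightarrow> ('c \<Rightarrow> 'c tens) \<Rightarrow> bool" where
  "local_deg_minus1 cdim ccl k phi \<longleftrightarrow>
     (\<forall>e. lie_len cdim (ccl e) k (phi e)) \<and>
     (\<forall>e w. phi e w \<noteq> 0 \<longrightarrow> wdeg cdim w = int (cdim e) - 2)"

end

theory Submission
  imports Defs "HOL-Library.Poly_Mapping"
begin

text \<open>
  The maps \<open>\<delta>\<^sub>k\<close> are built by induction on \<open>k\<close> and, for fixed \<open>k\<close>, cell by cell in order of dimension.
  If the relations of total index at most \<open>k\<close> hold, the obstruction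
  \<open>\<delta>\<^sub>2 \<delta>\<^bsub>k-1\<^esub> + \<dots> + \<delta>\<^bsub>k-1\<^esub> \<delta>\<^sub>2\<close> commutes with \<open>\<delta>\<^sub>1\<close>, so the value of \<open>\<delta>\<^sub>k\<close> on a cell \<open>e\<close> has to be
  a primitive of a cycle in the Lie elements of bracket length \<open>k\<close> on the closure of \<open>e\<close>. For \<open>k \<ge> 3\<close>
  this complex is acyclic: the closure is chain homotopy equivalent to a point, so a cycle in the
  \<open>k\<close>-th tensor power is \<open>c x\<^sup>k\<close> plus a boundary, where \<open>x\<close> is a 0-chain (of odd degree \<open>-1\<close>) generating
  the homology; the Dynkin operator is a chain map that multiplies Lie elements by \<open>k\<close>, and it kills
  \<open>x\<^sup>k\<close> because \<open>[x,[x,x]] = 0\<close>.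
\<close>

section \<open>The tensor algebra as a ring\<close>

text \<open>The bound 3 marks the place where the class of \<open>x\<close> dies. In length 2 one
  has [x,x] = 2 x^2, and the Dynkin operator doubles x^2 instead of killing it; so
  \<open>\<delta>\<^sub>2\<close> and its commutation relation must be given, while every later
  obstruction can be removed. A homotopy on a closure acts on one tensor factor and does not
  preserve Lie elements. Primitives are therefore sought among all tensors first and then moved into
  the Lie algebra by the Dynkin operator divided by \<open>k\<close>, which is possible over the
  rationals. The order by dimension is forced by the equation \<open>\<delta>\<^sub>1
  (\<delta>\<^sub>k e) = - Ob e - \<delta>\<^sub>k (\<delta>\<^sub>1 e)\<close>, with
  \<open>Ob\<close> the obstruction above: its last term uses the new map on faces of
  \<open>e\<close> only. The main technical burden is the Koszul signs. Degrees are carried as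
  explicit integer parameters, so that a sign is the parity of an integer expression and identities
  reduce to parity cases plus ring arithmetic.\<close>

instantiation list :: (type) monoid_add
begin

definition zero_list :: "'a list" where "0 = []"

definition plus_list :: "'a list \<Rightarrow> 'a list \<Rightarrow> 'a list" where "u + v = u @ v"

instance
  by standard (simp_all add: zero_list_def plus_list_def)

end

text \<open>The product of \<open>Poly_Mapping\<close> is convolution over an additive monoid.
  Concatenation was declared as addition of lists for this reason: the convolution ring is then the
  tensor algebra.\<close>

type_synonym 'c ta = "'c list \<Rightarrow>\<^sub>0 rat"

abbreviation coeff :: "'c ta \<Rightarrow> 'c tens" where
  "coeff \<equiv> Poly_Mapping.lookup"

abbreviation supp :: "'c ta \<Rightarrow> 'c list set" where
  "supp \<equiv> Poly_Mapping.keys"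

abbreviation mon :: "'c list \<Rightarrow> 'c ta" where
  "mon u \<equiv> Poly_Mapping.single u 1"

text \<open>Scalars are multiples of the empty word, so the vector space structure is part of the
  ring and linearity needs ring laws only.\<close>

definition scal :: "rat \<Rightarrow> 'c ta" where
  "scal q = Poly_Mapping.single [] q"

lemma mon_Nil [simp]: "mon [] = (1 :: 'c ta)"
  by (metis single_one zero_list_def)

lemma mon_append: "mon (u @ v) = (mon u * mon v :: 'c ta)"
  by (simp add: mult_single plus_list_def)

lemma single_eq_scal_mon: "Poly_Mapping.single u q = scal q * mon u"
  by (simp add: scal_def mult_single plus_list_def)

lemma scal_0 [simp]: "scal 0 = 0"
  and scal_1 [simp]: "scal 1 = 1"
  and scal_add: "scal (p + q) = scal p + scal q"
  and scal_mult: "scal (p * q) = scal p * scal q"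
  and scal_uminus: "scal (- q) = - scal q"
  by (simp_all add: scal_def single_add mult_single plus_list_def single_uminus)

lemma ta_expansion: "a = (\<Sum>u\<in>supp a. scal (coeff a u) * mon u)"
proof (rule poly_mapping_eqI)
  fix w
  have "coeff (\<Sum>u\<in>supp a. scal (coeff a u) * mon u) w
      = (\<Sum>u\<in>supp a. if u = w then coeff a u else 0)"
    by (simp add: lookup_sum single_eq_scal_mon[symmetric] lookup_single when_def)
  also have "\<dots> = coeff a w"
    by (simp add: in_keys_iff)
  finally show "coeff a w = coeff (\<Sum>u\<in>supp a. scal (coeff a u) * mon u) w"
    by simp
qed

lemma ta_span_induct [consumes 1, case_names mon zero add scal]:
  assumes sub: "supp a \<subseteq> U"
    and mon: "\<And>u. u \<in> U \<Longrightarrow> P (mon u)" and zero: "P 0"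
    and add: "\<And>a b. P a \<Longrightarrow> P b \<Longrightarrow> P (a + b)" and scal: "\<And>q a. P a \<Longrightarrow> P (scal q * a)"
  shows "P (a :: 'c ta)"
proof -
  have "P (\<Sum>u\<in>K. scal (coeff a u) * mon u)" if "finite K" "K \<subseteq> U" for K
    using that by (induction K) (auto intro: mon zero add scal)
  with sub show ?thesis
    by (subst ta_expansion) simp
qed

lemma scal_commute: "a * scal q = scal q * (a :: 'c ta)"
proof (rule ta_span_induct[of a UNIV])
  fix r and a :: "'c ta"
  assume "a * scal q = scal q * a"
  then have "scal r * a * scal q = scal (r * q) * a"
    by (simp add: mult.assoc scal_mult)
  also have "\<dots> = scal q * (scal r * a)"
    by (simp add: mult.commute[of r q] scal_mult mult.assoc)
  finally show "scal r * a * scal q = scal q * (scal r * a)" .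
qed (simp_all add: scal_def mult_single plus_list_def distrib_left distrib_right)

lemma lookup_scal_mult [simp]: "coeff (scal q * a) w = q * coeff a w"
proof -
  have "scal q * a = Poly_Mapping.map ((*) q) a"
    by (simp add: mult_map_scale_conv_mult scal_def zero_list_def)
  then show ?thesis
    by (simp add: Poly_Mapping.map.rep_eq when_def)
qed

section \<open>Linear maps and their extension from words\<close>

definition is_linear :: "('c ta \<Rightarrow> 'd ta) \<Rightarrow> bool" where
  "is_linear f \<longleftrightarrow> (\<forall>a b. f (a + b) = f a + f b) \<and> (\<forall>q a. f (scal q * a) = scal q * f a)"

lemma is_linearD:
  assumes "is_linear f"
  shows "f (a + b) = f a + f b" "f (scal q * a) = scal q * f a" "f 0 = 0" "f (- a) = - f a"
    "f (a - b) = f a - f b" "f (sum g I) = (\<Sum>i\<in>I. f (g i))"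
proof -
  show add: "f (a + b) = f a + f b" for a b using assms by (simp add: is_linear_def)
  show sc: "f (scal q * a) = scal q * f a" for q a using assms by (simp add: is_linear_def)
  show zero: "f 0 = 0" using sc[of 0 0] by simp
  show um: "f (- a) = - f a" for a using sc[of "-1" a] by (simp add: scal_uminus)
  show "f (a - b) = f a - f b" using add[of a "- b"] um[of b] by simp
  show "f (sum g I) = (\<Sum>i\<in>I. f (g i))"
    by (induction I rule: infinite_finite_induct) (simp_all add: zero add)
qed

lemma is_linear_id: "is_linear (\<lambda>a. a)"
  and is_linear_zero: "is_linear (\<lambda>a. 0)"
  and is_linear_comp: "is_linear f \<Longrightarrow> is_linear g \<Longrightarrow> is_linear (\<lambda>a. g (f a))"
  and is_linear_add: "is_linear f \<Longrightarrow> is_linear g' \<Longrightarrow> is_linear (\<lambda>a. f a + g' a)"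
  and is_linear_diff: "is_linear f \<Longrightarrow> is_linear g' \<Longrightarrow> is_linear (\<lambda>a. f a - g' a)"
  and is_linear_uminus: "is_linear f \<Longrightarrow> is_linear (\<lambda>a. - f a)"
  and is_linear_mult_right: "is_linear f \<Longrightarrow> is_linear (\<lambda>a. f a * c)"
  by (simp_all add: is_linear_def algebra_simps)

lemma is_linear_mult_left: "is_linear f \<Longrightarrow> is_linear (\<lambda>a. c * f a)"
  unfolding is_linear_def by (simp add: distrib_left mult.assoc[symmetric] scal_commute)

lemma is_linear_sum: "(\<And>i. i \<in> I \<Longrightarrow> is_linear (f i)) \<Longrightarrow> is_linear (\<lambda>a. \<Sum>i\<in>I. f i a)"
  by (simp add: is_linear_def sum.distrib sum_distrib_left)

lemmas is_linear_intros = is_linear_id is_linear_zero is_linear_add is_linear_diff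
  is_linear_uminus is_linear_mult_left is_linear_mult_right is_linear_sum

lemma is_linear_eqI:
  assumes "supp a \<subseteq> U" "is_linear f" "is_linear g" "\<And>u. u \<in> U \<Longrightarrow> f (mon u) = g (mon u)"
  shows "f a = g a"
  using assms(1) by (induction a rule: ta_span_induct) (simp_all add: assms(4) is_linearD[OF assms(2)] is_linearD[OF assms(3)])

definition lin :: "('c list \<Rightarrow> 'd ta) \<Rightarrow> 'c ta \<Rightarrow> 'd ta" where
  "lin F a = (\<Sum>u\<in>supp a. scal (coeff a u) * F u)"

lemma lin_superset:
  assumes "finite U" "supp a \<subseteq> U"
  shows "lin F a = (\<Sum>u\<in>U. scal (coeff a u) * F u)"
  unfolding lin_def using assms by (intro sum.mono_neutral_left) (auto simp: in_keys_iff)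

lemma is_linear_lin: "is_linear (lin F)"
  unfolding is_linear_def
proof (intro conjI allI)
  fix a b :: "'a ta" and q
  let ?U = "supp a \<union> supp b"
  show "lin F (a + b) = lin F a + lin F b"
    using keys_add[of a b]
    by (simp add: lin_superset[of ?U] lookup_add scal_add distrib_right sum.distrib)
  have "supp (scal q * a) \<subseteq> supp a"
    by (auto simp: in_keys_iff)
  then show "lin F (scal q * a) = scal q * lin F a"
    by (simp add: lin_superset[of "supp a"] scal_mult sum_distrib_left mult.assoc)
qed

lemma lin_mon [simp]: "lin F (mon u) = F u"
  by (simp add: lin_def)

lemma keys_scal_mult: "supp (scal q * a) \<subseteq> supp a"
  by (auto simp: in_keys_iff)

text \<open>A word of length n factors at exactly n + 1 cut positions. This is the shape in which
  \<open>lie\<close> is defined, and it later identifies \<open>brk\<close> with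
  \<open>lie\<close>.\<close>

lemma lookup_ta_mult:
  "coeff (a * b :: 'c ta) w = (\<Sum>i\<le>length w. coeff a (take i w) * coeff b (drop i w))"
proof -
  have eq: "coeff (mon u * b) w = (\<Sum>i\<le>length w. coeff (mon u) (take i w) * coeff b (drop i w))" for u
  proof (rule ta_span_induct[of b UNIV])
    fix v
    have "(\<Sum>i\<le>length w. coeff (mon u) (take i w) * coeff (mon v) (drop i w))
        = (\<Sum>i\<le>length w. if i = length u then (if w = u @ v then 1 else 0) else (0::rat))"
    proof (intro sum.cong refl)
      fix i assume "i \<in> {..length w}"
      then have "u = take i w \<and> v = drop i w \<longleftrightarrow> i = length u \<and> w = u @ v"
        by auto
      moreover have "coeff (mon u) (take i w) * coeff (mon v) (drop i w)
          = (if u = take i w \<and> v = drop i w then 1 else (0::rat))"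
        by (simp add: lookup_single when_def)
      ultimately show "coeff (mon u) (take i w) * coeff (mon v) (drop i w)
          = (if i = length u then (if w = u @ v then 1 else 0) else (0::rat))"
        by presburger
    qed
    also have "\<dots> = coeff (mon u * mon v) w"
      by (auto simp: lookup_single when_def mon_append[symmetric])
    finally show "coeff (mon u * mon v) w = (\<Sum>i\<le>length w. coeff (mon u) (take i w) * coeff (mon v) (drop i w))"
      by simp
  next
    fix q and b :: "'c ta"
    assume *: "coeff (mon u * b) w = (\<Sum>i\<le>length w. coeff (mon u) (take i w) * coeff b (drop i w))"
    have "mon u * (scal q * b) = scal q * (mon u * b)"
      by (simp add: mult.assoc[symmetric] scal_commute)
    then show "coeff (mon u * (scal q * b)) w = (\<Sum>i\<le>length w. coeff (mon u) (take i w) * coeff (scal q * b) (drop i w))"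
      by (simp add: * sum_distrib_left mult_ac)
  qed (simp_all add: distrib_left lookup_add sum.distrib)
  show ?thesis
    by (rule ta_span_induct[of a UNIV])
      (simp_all add: eq distrib_right lookup_add sum.distrib mult.assoc sum_distrib_left)
qed

section \<open>Subspaces spanned by sets of words\<close>

definition spn :: "'c list set \<Rightarrow> 'c ta set" where
  "spn U = {a. supp a \<subseteq> U}"

lemma spn_zero [simp]: "0 \<in> spn U"
  and spn_mon: "u \<in> U \<Longrightarrow> mon u \<in> spn U"
  and spn_mono: "a \<in> spn U \<Longrightarrow> U \<subseteq> V \<Longrightarrow> a \<in> spn V"
  by (auto simp: spn_def)

lemma spn_add: "a \<in> spn U \<Longrightarrow> b \<in> spn U \<Longrightarrow> a + b \<in> spn U"
  using keys_add[of a b] by (auto simp: spn_def)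

lemma spn_scal: "a \<in> spn U \<Longrightarrow> scal q * a \<in> spn U"
  using keys_scal_mult[of q a] by (auto simp: spn_def)

lemma spn_uminus: "a \<in> spn U \<Longrightarrow> - a \<in> spn U"
  by (auto simp: spn_def in_keys_iff)

lemma spn_diff: "a \<in> spn U \<Longrightarrow> b \<in> spn U \<Longrightarrow> a - b \<in> spn U"
  using spn_add[of a U "- b"] spn_uminus[of b U] by simp

lemma spn_sum: "(\<And>i. i \<in> I \<Longrightarrow> f i \<in> spn U) \<Longrightarrow> sum f I \<in> spn U"
  by (induction I rule: infinite_finite_induct) (auto intro: spn_add)

lemma spn_mult:
  assumes "a \<in> spn U" "b \<in> spn V" "\<And>u v. u \<in> U \<Longrightarrow> v \<in> V \<Longrightarrow> u @ v \<in> W"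
  shows "a * b \<in> spn W"
  using keys_mult[of a b] assms by (fastforce simp: spn_def plus_list_def)

lemma spn_lin:
  assumes "a \<in> spn U" "\<And>u. u \<in> U \<Longrightarrow> F u \<in> spn W"
  shows "lin F a \<in> spn W"
  unfolding lin_def using assms by (intro spn_sum spn_scal) (auto simp: spn_def)

lemma spn_induct [consumes 1, case_names mon zero add scal]:
  assumes "a \<in> spn U" "\<And>u. u \<in> U \<Longrightarrow> P (mon u)" "P 0"
    "\<And>a b. P a \<Longrightarrow> P b \<Longrightarrow> P (a + b)" "\<And>q a. P a \<Longrightarrow> P (scal q * a)"
  shows "P (a :: 'c ta)"
  by (rule ta_span_induct[of a U P]) (use assms in \<open>auto simp: spn_def\<close>)

lemma spn_eqI:
  assumes "a \<in> spn U" "is_linear f" "is_linear g" "\<And>u. u \<in> U \<Longrightarrow> f (mon u) = g (mon u)"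
  shows "f a = g a"
  by (rule is_linear_eqI[of a U]) (use assms in \<open>auto simp: spn_def\<close>)

text \<open>Polymorphic in the ring, so that a sign can multiply a tensor directly;
  \<open>sgn_of\<close> is its rational counterpart.\<close>

definition sg :: "int \<Rightarrow> 'a::ring_1" where
  "sg n = (if even n then 1 else - 1)"

lemma spn_sg: "a \<in> spn U \<Longrightarrow> sg n * a \<in> spn U"
  by (simp add: sg_def spn_uminus)

lemma scal_left_commute: "a * (scal q * b) = scal q * (a * b :: 'c ta)"
  by (simp add: mult.assoc[symmetric] scal_commute)

section \<open>Grading by word length and by degree\<close>

locale graded_cells =
  fixes cdim :: "'c \<Rightarrow> nat"
begin

abbreviation deg :: "'c list \<Rightarrow> int" where
  "deg \<equiv> wdeg cdim"

lemma deg_Nil [simp]: "deg [] = 0"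
  and deg_Cons: "deg (e # w) = int (cdim e) - 1 + deg w"
  and deg_append [simp]: "deg (u @ v) = deg u + deg v"
  by (simp_all add: wdeg_def)

definition words :: "'c set \<Rightarrow> nat \<Rightarrow> int \<Rightarrow> 'c list set" where
  "words S k n = {u. set u \<subseteq> S \<and> length u = k \<and> deg u = n}"

abbreviation hdeg :: "int \<Rightarrow> 'c ta set" where
  "hdeg n \<equiv> spn {u. deg u = n}"

abbreviation tens_on :: "'c set \<Rightarrow> nat \<Rightarrow> int \<Rightarrow> 'c ta set" where
  "tens_on S k n \<equiv> spn (words S k n)"

lemma tens_on_hdeg: "a \<in> tens_on S k n \<Longrightarrow> a \<in> hdeg n"
  by (erule spn_mono) (auto simp: words_def)

lemma hdeg_mult: "a \<in> hdeg m \<Longrightarrow> b \<in> hdeg n \<Longrightarrow> a * b \<in> hdeg (m + n)"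
  by (erule spn_mult) auto

lemma tens_on_mult: "a \<in> tens_on S i m \<Longrightarrow> b \<in> tens_on S j n \<Longrightarrow> a * b \<in> tens_on S (i + j) (m + n)"
  by (erule spn_mult) (auto simp: words_def)

lemma tens_on_gen: "e \<in> S \<Longrightarrow> n = int (cdim e) - 1 \<Longrightarrow> mon [e] \<in> tens_on S 1 n"
  by (intro spn_mon) (simp add: words_def deg_Cons)

lemma hdeg_mon [simp]: "mon u \<in> hdeg (deg u)"
  by (intro spn_mon) simp

section \<open>Odd derivations\<close>

text \<open>Recursive form of \<open>dword\<close>: the derivation either hits the first letter or
  passes it at the cost of the sign of its degree. The agreement with the sum over positions is
  \<open>dmon_dword\<close>.\<close>

primrec dmon :: "('c \<Rightarrow> 'c ta) \<Rightarrow> 'c list \<Rightarrow> 'c ta" where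
  "dmon \<Phi> [] = 0"
| "dmon \<Phi> (e # w) = \<Phi> e * mon w + sg (int (cdim e) - 1) * (mon [e] * dmon \<Phi> w)"

definition D :: "('c \<Rightarrow> 'c ta) \<Rightarrow> 'c ta \<Rightarrow> 'c ta" where
  "D \<Phi> = lin (dmon \<Phi>)"

lemma is_linear_D: "is_linear (D \<Phi>)"
  by (simp add: D_def is_linear_lin)

lemmas D_linear = is_linearD[OF is_linear_D]

lemma D_gen: "D \<Phi> (mon [e]) = \<Phi> e"
  by (simp add: D_def)

lemma dmon_append: "dmon \<Phi> (u @ v) = dmon \<Phi> u * mon v + sg (deg u) * (mon u * dmon \<Phi> v)"
proof (induction u)
  case (Cons e u)
  have "mon (e # u) = mon [e] * mon u"
    using mon_append[of "[e]" u] by simp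
  with Cons show ?case
    by (simp add: deg_Cons mon_append distrib_left distrib_right mult.assoc sg_def)
qed (simp add: sg_def)

lemma D_mult:
  assumes "a \<in> hdeg n"
  shows "D \<Phi> (a * b) = D \<Phi> a * b + sg n * (a * D \<Phi> b)"
proof -
  have *: "D \<Phi> (mon u * b) = D \<Phi> (mon u) * b + sg (deg u) * (mon u * D \<Phi> b)" for u
    by (rule is_linear_eqI[of b UNIV])
      (intro is_linear_intros is_linear_comp[OF _ is_linear_D]
       | simp add: mon_append[symmetric] D_def dmon_append)+
  show ?thesis
    by (rule spn_eqI[OF assms])
      (intro is_linear_intros is_linear_comp[OF _ is_linear_D] | simp add: *)+
qed

lemma D_one [simp]: "D \<Phi> 1 = 0"
  by (metis D_def dmon.simps(1) lin_mon mon_Nil)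

text \<open>The generator \<open>e\<close> has degree \<open>cdim e - 1\<close>, so the
  \<open>- 2\<close> means that the degree drops by one.\<close>

definition odd_map :: "('c \<Rightarrow> 'c ta) \<Rightarrow> bool" where
  "odd_map \<Phi> \<longleftrightarrow> (\<forall>e. \<Phi> e \<in> hdeg (int (cdim e) - 2))"

lemma dmon_hdeg:
  assumes "odd_map \<Phi>"
  shows "dmon \<Phi> u \<in> hdeg (deg u - 1)"
proof (induction u)
  case (Cons e u)
  have "\<Phi> e * mon u \<in> hdeg (int (cdim e) - 2 + deg u)"
    using assms by (intro hdeg_mult) (simp_all add: odd_map_def)
  moreover have "mon [e] * dmon \<Phi> u \<in> hdeg (deg [e] + (deg u - 1))"
    using Cons by (intro hdeg_mult) simp_all
  ultimately show ?case
    by (simp add: deg_Cons spn_add spn_sg algebra_simps)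
qed simp

lemma D_hdeg:
  assumes "odd_map \<Phi>" "a \<in> hdeg n"
  shows "D \<Phi> a \<in> hdeg (n - 1)"
  unfolding D_def using assms(2) by (rule spn_lin) (use dmon_hdeg[OF assms(1)] in auto)

text \<open>The degrees are arguments instead of being read off from the tensors. This keeps
  \<open>brk\<close> bilinear for fixed degrees and gives a definite sign even for zero, which lies
  in every degree.\<close>

definition brk :: "int \<Rightarrow> int \<Rightarrow> 'c ta \<Rightarrow> 'c ta \<Rightarrow> 'c ta" where
  "brk m n a b = a * b - sg (m * n) * (b * a)"

lemma brk_hdeg: "a \<in> hdeg m \<Longrightarrow> b \<in> hdeg n \<Longrightarrow> brk m n a b \<in> hdeg (m + n)"
  unfolding brk_def using hdeg_mult[of a m b n] hdeg_mult[of b n a m]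
  by (simp add: spn_diff spn_sg add.commute)

lemma brk_linear:
  "brk m n (a + a') b = brk m n a b + brk m n a' b" "brk m n a (b + b') = brk m n a b + brk m n a b'"
  "brk m n (scal q * a) b = scal q * brk m n a b" "brk m n a (scal q * b) = scal q * brk m n a b"
  "brk m n 0 b = 0" "brk m n a 0 = 0"
  by (simp_all add: brk_def distrib_left distrib_right right_diff_distrib mult.assoc
      scal_left_commute)

lemma D_brk:
  assumes "odd_map \<Phi>" "a \<in> hdeg m" "b \<in> hdeg n"
  shows "D \<Phi> (brk m n a b) = brk (m - 1) n (D \<Phi> a) b + sg m * brk m (n - 1) a (D \<Phi> b)"
proof -
  have "D \<Phi> (sg k * c) = sg k * D \<Phi> c" for k c
    by (simp add: sg_def D_linear)
  then show ?thesis
    by (simp add: brk_def D_linear D_mult[OF assms(2)] D_mult[OF assms(3)])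
      (simp add: sg_def distrib_left distrib_right left_diff_distrib right_diff_distrib)
qed

section \<open>Homogeneous Lie elements\<close>

text \<open>In contrast to \<open>lie_len\<close>, sums are only formed within one degree, so that
  \<open>brk\<close> has the right sign at every node of the induction.\<close>

inductive lie_hom :: "'c set \<Rightarrow> nat \<Rightarrow> int \<Rightarrow> 'c ta \<Rightarrow> bool" for S where
  gen: "e \<in> S \<Longrightarrow> n = int (cdim e) - 1 \<Longrightarrow> lie_hom S 1 n (mon [e])"
| zero: "lie_hom S k n 0"
| add: "lie_hom S k n a \<Longrightarrow> lie_hom S k n b \<Longrightarrow> lie_hom S k n (a + b)"
| scal: "lie_hom S k n a \<Longrightarrow> lie_hom S k n (scal q * a)"
| brk: "lie_hom S i m a \<Longrightarrow> lie_hom S j n b \<Longrightarrow> lie_hom S (i + j) (m + n) (brk m n a b)"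

lemma lie_hom_uminus: "lie_hom S k n a \<Longrightarrow> lie_hom S k n (- a)"
  using lie_hom.scal[of S k n a "- 1"] by (simp add: scal_uminus)

lemma lie_hom_diff: "lie_hom S k n a \<Longrightarrow> lie_hom S k n b \<Longrightarrow> lie_hom S k n (a - b)"
  using lie_hom.add[of S k n a "- b"] by (simp add: lie_hom_uminus)

lemma lie_hom_sg: "lie_hom S k n a \<Longrightarrow> lie_hom S k n (sg m * a)"
  by (simp add: sg_def lie_hom_uminus)

lemma lie_hom_sum: "(\<And>i. i \<in> I \<Longrightarrow> lie_hom S k n (f i)) \<Longrightarrow> lie_hom S k n (sum f I)"
  by (induction I rule: infinite_finite_induct) (auto intro: lie_hom.intros)

lemma lie_hom_mono: "lie_hom S k n a \<Longrightarrow> S \<subseteq> S' \<Longrightarrow> lie_hom S' k n a"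
proof (induction rule: lie_hom.induct)
  case (gen e n)
  then show ?case by (intro lie_hom.gen) auto
qed (auto intro: lie_hom.intros)

lemma lie_hom_tens_on: "lie_hom S k n a \<Longrightarrow> a \<in> tens_on S k n"
proof (induction rule: lie_hom.induct)
  case (brk i m a j n b)
  then show ?case
    using tens_on_mult[of a S i m b j n] tens_on_mult[of b S j n a i m]
    by (simp add: brk_def spn_diff spn_sg add.commute)
qed (auto intro: tens_on_gen[simplified] spn_add spn_scal)

lemma lie_hom_hdeg: "lie_hom S k n a \<Longrightarrow> a \<in> hdeg n"
  by (rule tens_on_hdeg) (rule lie_hom_tens_on)

text \<open>Length 0 enters only through the rule \<open>zero\<close>. The lemma disposes of
  degenerate brackets in the Specht-Wever argument, which needs both factors to consist of nonempty
  words.\<close>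

lemma lie_hom_0: "lie_hom S k n a \<Longrightarrow> k = 0 \<Longrightarrow> a = 0"
  by (induction rule: lie_hom.induct) (auto simp: brk_linear)

text \<open>A derivation of the product is one of the bracket, so induction over brackets works.
  Replacing one generator by an element of length \<open>Suc j\<close> lengthens the bracket by
  \<open>j\<close>.\<close>

lemma lie_hom_D:
  assumes "odd_map \<Phi>" and \<Phi>: "\<And>e. e \<in> S \<Longrightarrow> lie_hom S (Suc j) (int (cdim e) - 2) (\<Phi> e)"
    and "lie_hom S k n a"
  shows "lie_hom S (k + j) (n - 1) (D \<Phi> a)"
  using assms(3)
proof (induction rule: lie_hom.induct)
  case (gen e n)
  then show ?case using \<Phi>[of e] by (simp add: D_gen)
next
  case (brk i m a i' n b)
  have "lie_hom S ((i + j) + i') ((m - 1) + n) (brk (m - 1) n (D \<Phi> a) b)"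
    by (intro lie_hom.brk brk)
  moreover have "lie_hom S (i + (i' + j)) (m + (n - 1)) (brk m (n - 1) a (D \<Phi> b))"
    by (intro lie_hom.brk brk)
  ultimately have "lie_hom S (i + i' + j) (m + n - 1)
      (brk (m - 1) n (D \<Phi> a) b + sg m * brk m (n - 1) a (D \<Phi> b))"
    by (intro lie_hom.add lie_hom_sg) (simp_all add: algebra_simps)
  then show ?case
    using brk by (simp add: D_brk[OF assms(1)] lie_hom_hdeg)
qed (simp_all add: D_linear lie_hom.intros)

lemma tens_on_1_lie_hom:
  assumes "a \<in> tens_on S 1 n"
  shows "lie_hom S 1 n a"
  using assms
proof (induction rule: spn_induct)
  case (mon u)
  then obtain e where "u = [e]" "e \<in> S" "n = int (cdim e) - 1"
    by (auto simp: words_def length_Suc_conv deg_Cons)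
  then show ?case by (metis lie_hom.gen)
qed (auto intro: lie_hom.intros)

lemma D_tens_on:
  assumes \<Phi>: "\<And>e. e \<in> S \<Longrightarrow> \<Phi> e \<in> tens_on S 1 (int (cdim e) - 2)" and a: "a \<in> tens_on S k n"
  shows "D \<Phi> a \<in> tens_on S k (n - 1)"
proof -
  have *: "dmon \<Phi> u \<in> tens_on S (length u) (deg u - 1)" if "set u \<subseteq> S" for u
    using that
  proof (induction u)
    case (Cons e u)
    have "\<Phi> e * mon u \<in> tens_on S (1 + length u) (int (cdim e) - 2 + deg u)"
      using Cons by (intro tens_on_mult \<Phi> spn_mon) (simp_all add: words_def)
    moreover have "mon [e] * dmon \<Phi> u \<in> tens_on S (1 + length u) (int (cdim e) - 1 + (deg u - 1))"
      using Cons by (intro tens_on_mult tens_on_gen) simp_all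
    ultimately show ?case
      by (simp add: deg_Cons spn_add spn_sg algebra_simps)
  qed simp
  show ?thesis
    unfolding D_def using a by (rule spn_lin) (use * in \<open>auto simp: words_def\<close>)
qed

section \<open>The Dynkin operator\<close>

text \<open>The right-normed bracket [e_1, [e_2, ..., [e_{n-1}, e_n]]]. One-letter words are a
  separate case because continuing to \<open>pmon [] = 0\<close> would make everything
  vanish.\<close>

primrec pmon :: "'c list \<Rightarrow> 'c ta" where
  "pmon [] = 0"
| "pmon (e # w) = (if w = [] then mon [e] else brk (int (cdim e) - 1) (deg w) (mon [e]) (pmon w))"

definition dynkin :: "'c ta \<Rightarrow> 'c ta" where
  "dynkin = lin pmon"

lemma is_linear_dynkin: "is_linear dynkin"
  by (simp add: dynkin_def is_linear_lin)

lemmas dynkin_linear = is_linearD[OF is_linear_dynkin]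

lemma lie_hom_pmon: "set w \<subseteq> S \<Longrightarrow> lie_hom S (length w) (deg w) (pmon w)"
proof (induction w)
  case (Cons e w)
  show ?case
  proof (cases "w = []")
    case True
    with Cons show ?thesis
      using lie_hom.gen[of e S "int (cdim e) - 1"] by (simp add: deg_Cons)
  next
    case False
    have "lie_hom S (1 + length w) (int (cdim e) - 1 + deg w)
        (brk (int (cdim e) - 1) (deg w) (mon [e]) (pmon w))"
      using Cons by (intro lie_hom.brk lie_hom.gen) auto
    with False show ?thesis by (simp add: deg_Cons)
  qed
qed (simp add: lie_hom.zero)

lemma lie_hom_dynkin:
  assumes "a \<in> tens_on S k n"
  shows "lie_hom S k n (dynkin a)"
  using assms
proof (induction rule: spn_induct)
  case (mon u)
  then show ?case using lie_hom_pmon[of u S] by (auto simp: words_def dynkin_def)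
qed (auto simp: dynkin_linear intro: lie_hom.intros)

text \<open>The algebra homomorphism \<open>T(V) \<rightarrow> End(T(V))\<close> extending \<open>ad\<close>; only its effect on an
  argument \<open>b\<close> of fixed degree \<open>q\<close> is recorded, so that the signs depend on words alone.\<close>

primrec admon :: "int \<Rightarrow> 'c ta \<Rightarrow> 'c list \<Rightarrow> 'c ta" where
  "admon q b [] = b"
| "admon q b (e # u) = brk (int (cdim e) - 1) (deg u + q) (mon [e]) (admon q b u)"

definition ad :: "int \<Rightarrow> 'c ta \<Rightarrow> 'c ta \<Rightarrow> 'c ta" where
  "ad q a b = lin (admon q b) a"

lemma is_linear_ad_left: "is_linear (\<lambda>a. ad q a b)"
  by (simp add: ad_def is_linear_lin)

lemma is_linear_brk_right: "is_linear (brk m n a)"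
  by (simp add: is_linear_def brk_linear)

lemma is_linear_admon: "is_linear (\<lambda>b. admon q b u)"
  by (induction u) (simp_all add: is_linear_id is_linear_comp[OF _ is_linear_brk_right])

lemma is_linear_ad_right: "is_linear (\<lambda>b. ad q a b)"
  unfolding ad_def lin_def
  by (intro is_linear_sum is_linear_mult_left is_linear_admon)

lemmas ad_linear = is_linearD[OF is_linear_ad_left] is_linearD[OF is_linear_ad_right]

lemma admon_append: "admon q b (u @ v) = admon (deg v + q) (admon q b v) u"
  by (induction u) (simp_all add: algebra_simps)

text \<open>Multiplicativity of the action. The inner value has degree \<open>r + q\<close>, and the
  outer action has to be told so in order to choose its signs.\<close>

lemma ad_mult:
  assumes "c \<in> hdeg r"
  shows "ad q (a * c) b = ad (r + q) a (ad q c b)"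
proof -
  have *: "ad q (mon u * c) b = ad (r + q) (mon u) (ad q c b)" for u
    by (rule spn_eqI[OF assms])
      (intro is_linear_intros is_linear_comp[OF _ is_linear_ad_left] is_linear_comp[OF _ is_linear_ad_right]
       | simp add: ad_def mon_append[symmetric] admon_append)+
  show ?thesis
    by (rule is_linear_eqI[of a UNIV])
      (intro is_linear_intros is_linear_ad_left is_linear_comp[OF _ is_linear_ad_left[of q b]] | simp add: *)+
qed

text \<open>By definition \<open>ad\<close> acts by brackets only through single generators. That a
  whole Lie element acts by its own bracket is the graded Jacobi identity, applied at each bracket
  of the induction.\<close>

lemma ad_lie_hom:
  assumes "lie_hom S k m a" "b \<in> hdeg q"
  shows "ad q a b = brk m q a b"
  using assms
proof (induction arbitrary: q b rule: lie_hom.induct)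
  case (gen e n)
  then show ?case by (simp add: ad_def)
next
  case (brk i m a j n c)
  have a: "a \<in> hdeg m" and c: "c \<in> hdeg n"
    using brk by (auto intro: lie_hom_hdeg)
  have sg: "ad q (sg l * d) b = sg l * ad q d b" for l d
    by (simp add: sg_def ad_linear)
  have "ad q (brk m n a c) b = ad (n + q) a (ad q c b) - sg (m * n) * ad (m + q) c (ad q a b)"
    by (simp add: brk_def ad_linear ad_mult[OF a] ad_mult[OF c] sg)
  also have "\<dots> = brk m (n + q) a (brk n q c b) - sg (m * n) * brk n (m + q) c (brk m q a b)"
    using brk by (simp add: brk_hdeg a c)
  \<comment> \<open>Graded Jacobi identity, checked by expanding into associative products and
    splitting on the parities of the degrees.\<close>
  also have "\<dots> = brk (m + n) q (brk m n a c) b"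
    by (simp add: brk_def sg_def distrib_left distrib_right left_diff_distrib right_diff_distrib mult.assoc)
  finally show ?case .
qed (simp_all add: ad_linear brk_linear)

text \<open>Nesting brackets to the right lets a left factor act on the Dynkin image of the right
  one. The right factor must avoid the empty word, where \<open>pmon\<close> starts from 0 and not
  from a letter.\<close>

lemma dynkin_mult:
  assumes "c \<in> spn {v. v \<noteq> [] \<and> deg v = r}"
  shows "dynkin (a * c) = ad r a (dynkin c)"
proof -
  have p: "pmon (u @ v) = admon (deg v) (pmon v) u" if "v \<noteq> []" for u v
    using that by (induction u) (simp_all add: algebra_simps)
  have *: "dynkin (mon u * c) = ad r (mon u) (dynkin c)" for u
    by (rule spn_eqI[OF assms])
      (intro is_linear_intros is_linear_comp[OF _ is_linear_dynkin] is_linear_comp[OF _ is_linear_ad_right]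
       is_linear_dynkin
       | simp add: ad_def mon_append[symmetric] dynkin_def p)+
  show ?thesis
    by (rule is_linear_eqI[of a UNIV])
      (intro is_linear_intros is_linear_ad_left is_linear_comp[OF _ is_linear_dynkin] | simp add: *)+
qed

lemma tens_on_nonempty: "a \<in> tens_on S k n \<Longrightarrow> k \<noteq> 0 \<Longrightarrow> a \<in> spn {v. v \<noteq> [] \<and> deg v = n}"
  by (erule spn_mono) (auto simp: words_def)

text \<open>Dynkin-Specht-Wever theorem. In a bracket [a,b] the product ab contributes the length of
  b times [a,b], and the term in ba contributes the length of a times [a,b], by graded
  antisymmetry.\<close>

lemma dynkin_specht_wever: "lie_hom S k n a \<Longrightarrow> dynkin a = scal (of_nat k) * a"
proof (induction rule: lie_hom.induct)
  case (brk i m a j n b)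
  show ?case
  proof (cases "i = 0 \<or> j = 0")
    case True
    then have "a = 0 \<or> b = 0"
      using brk lie_hom_0 by blast
    then show ?thesis by (auto simp: brk_linear dynkin_linear)
  next
    case False
    have a: "a \<in> spn {v. v \<noteq> [] \<and> deg v = m}" and b: "b \<in> spn {v. v \<noteq> [] \<and> deg v = n}"
      using brk False lie_hom_tens_on tens_on_nonempty by blast+
    have sg: "dynkin (sg l * d) = sg l * dynkin d" for l d
      by (simp add: sg_def dynkin_linear)
    have "dynkin (brk m n a b) = ad n a (dynkin b) - sg (m * n) * ad m b (dynkin a)"
      by (simp add: brk_def dynkin_linear dynkin_mult[OF a] dynkin_mult[OF b] sg)
    also have "\<dots> = scal (of_nat j) * brk m n a b - sg (m * n) * (scal (of_nat i) * brk n m b a)"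
      using brk by (simp add: ad_linear ad_lie_hom lie_hom_hdeg)
    also have "\<dots> = scal (of_nat (i + j)) * brk m n a b"
      by (simp add: brk_def sg_def scal_add distrib_left distrib_right left_diff_distrib right_diff_distrib mult.assoc)
    finally show ?thesis .
  qed
next
  case (scal k n a q)
  then show ?case
    by (simp add: dynkin_linear scal_mult[symmetric] mult.assoc[symmetric] mult.commute)
qed (simp_all add: dynkin_linear distrib_left, simp add: dynkin_def)

text \<open>Both sides obey the same recursion along a word, since \<open>D\<close> is a derivation
  of brackets. The base case uses that \<open>\<Phi>\<close> has values of word length 1, which
  \<open>dynkin\<close> fixes.\<close>

lemma dynkin_D:
  assumes \<Phi>: "\<And>e. \<Phi> e \<in> tens_on UNIV 1 (int (cdim e) - 2)"
  shows "dynkin (D \<Phi> a) = D \<Phi> (dynkin a)"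
proof -
  have odd: "odd_map \<Phi>"
    using \<Phi> by (auto simp: odd_map_def intro: tens_on_hdeg)
  have lie: "lie_hom UNIV 1 (int (cdim e) - 2) (\<Phi> e)" for e
    using \<Phi> by (rule tens_on_1_lie_hom)
  have "dynkin (dmon \<Phi> w) = D \<Phi> (pmon w)" for w
  proof (induction w)
    case (Cons e w)
    show ?case
    proof (cases "w = []")
      case True
      then show ?thesis using dynkin_specht_wever[OF lie[of e]] by (simp add: D_gen)
    next
      case False
      have "mon w \<in> tens_on UNIV (length w) (deg w)"
        by (intro spn_mon) (simp add: words_def)
      moreover from this have "D \<Phi> (mon w) \<in> tens_on UNIV (length w) (deg w - 1)"
        using \<Phi> by (rule D_tens_on[rotated])
      ultimately have w: "mon w \<in> spn {v. v \<noteq> [] \<and> deg v = deg w}"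
        "dmon \<Phi> w \<in> spn {v. v \<noteq> [] \<and> deg v = deg w - 1}"
        using False by (auto intro: tens_on_nonempty simp: D_def)
      have pw: "pmon w \<in> hdeg (deg w)"
        by (rule lie_hom_hdeg[OF lie_hom_pmon[of w UNIV]]) simp
      have e: "mon [e] \<in> hdeg (int (cdim e) - 1)"
        using hdeg_mon[of "[e]"] by (simp add: deg_Cons)
      have "lie_hom UNIV 1 (int (cdim e) - 1) (mon [e])"
        by (rule lie_hom.gen) simp_all
      then have "dynkin (mon [e] * dmon \<Phi> w) = brk (int (cdim e) - 1) (deg w - 1) (mon [e]) (D \<Phi> (pmon w))"
        using D_hdeg[OF odd pw] by (simp add: dynkin_mult[OF w(2)] Cons ad_lie_hom)
      moreover have "dynkin (\<Phi> e * mon w) = brk (int (cdim e) - 2) (deg w) (\<Phi> e) (pmon w)"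
        using pw by (simp add: dynkin_mult[OF w(1)] ad_lie_hom[OF lie]) (simp add: dynkin_def ad_lie_hom[OF lie])
      moreover have "dynkin (sg l * d) = sg l * dynkin d" for l d
        by (simp add: sg_def dynkin_linear)
      ultimately show ?thesis
        using False by (simp add: dynkin_linear D_brk[OF odd e pw] D_gen)
    qed
  qed (simp add: dynkin_linear D_linear)
  then show ?thesis
    by - (rule is_linear_eqI[OF subset_UNIV is_linear_comp[OF is_linear_D is_linear_dynkin]
          is_linear_comp[OF is_linear_dynkin is_linear_D]], simp add: D_def dynkin_def)
qed

lemma tens_on_power:
  assumes "x \<in> tens_on S 1 (- 1)"
  shows "x ^ k \<in> tens_on S k (- int k)"
proof (induction k)
  case 0
  show ?case using spn_mon[of "[]" "words S 0 0"] by (simp add: words_def)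
next
  case (Suc k)
  then show ?case using tens_on_mult[OF assms Suc] by simp
qed

text \<open>This reflects \<open>[x,[x,x]] = 0\<close> for odd \<open>x\<close>.\<close>

lemma dynkin_power:
  assumes x: "x \<in> tens_on S 1 (- 1)" and "k \<ge> 3"
  shows "dynkin (x ^ k) = 0"
proof -
  have lie: "lie_hom S 1 (- 1) x"
    using x by (rule tens_on_1_lie_hom)
  have pow: "dynkin (x * x ^ k) = ad (- int k) x (dynkin (x ^ k))" if "k > 0" for k
    using that by (intro dynkin_mult tens_on_nonempty[OF tens_on_power[OF x]]) simp
  have h: "x * x \<in> hdeg (- 2)"
    using hdeg_mult[of x "- 1" x "- 1"] tens_on_hdeg[OF x] by simp
  have 1: "dynkin (x ^ 1) = x"
    using dynkin_specht_wever[OF lie] by simp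
  have 2: "dynkin (x ^ 2) = x * x + x * x"
    using pow[of 1] 1 tens_on_hdeg[OF x] by (simp add: power2_eq_square ad_lie_hom[OF lie] brk_def sg_def)
  have 3: "dynkin (x ^ 3) = 0"
  proof -
    \<comment> \<open>The degrees -1 and -2 give an even sign, so this is the ordinary commutator of
      \<open>x\<close> with 2 x^2.\<close>
    have "dynkin (x ^ 3) = brk (- 1) (- 2) x (x * x + x * x)"
      using pow[of 2] ad_lie_hom[OF lie spn_add[OF h h]] by (simp add: 2 power_Suc[symmetric])
    then show ?thesis
      by (simp add: brk_def sg_def distrib_left distrib_right mult.assoc)
  qed
  show ?thesis
    using \<open>k \<ge> 3\<close>
  proof (induction rule: dec_induct)
    case (step n)
    then show ?case using pow[of n] by (simp add: ad_linear)
  qed (rule 3)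
qed

section \<open>Acyclicity of Lie elements of bracket length at least three\<close>

text \<open>The map g tensor identity: \<open>g\<close> acts on the first letter only. With a chain
  homotopy for \<open>g\<close> it is a homotopy on tensors; with a scalar-valued \<open>g\<close>
  it evaluates an augmentation on the first factor and deletes it.\<close>

definition contr :: "('c \<Rightarrow> 'c ta) \<Rightarrow> 'c ta \<Rightarrow> 'c ta" where
  "contr g = lin (\<lambda>w. case w of [] \<Rightarrow> 0 | e # v \<Rightarrow> g e * mon v)"

lemma is_linear_contr: "is_linear (contr g)"
  by (simp add: contr_def is_linear_lin)

lemmas contr_linear = is_linearD[OF is_linear_contr]

lemma contr_mon [simp]: "contr g (mon (e # v)) = g e * mon v"
  by (simp add: contr_def)

lemma contr_mult:
  assumes "a \<in> tens_on S 1 n"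
  shows "contr g (a * b) = contr g a * b"
proof -
  have *: "contr g (mon [e] * b) = contr g (mon [e]) * b" for e
    by (rule is_linear_eqI[of b UNIV])
      (intro is_linear_intros is_linear_comp[OF _ is_linear_contr] | simp add: mon_append[symmetric])+
  show ?thesis
  proof (rule spn_eqI[OF assms])
    fix u assume "u \<in> words S 1 n"
    then obtain e where "u = [e]" by (auto simp: words_def length_Suc_conv)
    then show "contr g (mon u * b) = contr g (mon u) * b"
      using * by simp
  qed (intro is_linear_intros is_linear_contr is_linear_comp[OF _ is_linear_contr])+
qed

lemma words_1_E:
  assumes "u \<in> words S 1 n"
  obtains e where "u = [e]" "e \<in> S" "n = int (cdim e) - 1"
  using assms by (auto simp: words_def length_Suc_conv deg_Cons)

lemma tens_on_1_eqI:
  assumes "a \<in> tens_on S 1 n" "is_linear f" "is_linear g"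
    "\<And>e. e \<in> S \<Longrightarrow> n = int (cdim e) - 1 \<Longrightarrow> f (mon [e]) = g (mon [e])"
  shows "f a = g a"
  by (rule spn_eqI[OF assms(1-3)]) (auto elim!: words_1_E[unfolded One_nat_def] simp: assms(4))

lemma tens_on_1_trivial:
  assumes "a \<in> tens_on S 1 n" "n < - 1"
  shows "a = 0"
  by (rule tens_on_1_eqI[OF assms(1) is_linear_id is_linear_zero]) (use assms(2) in auto)

lemma contr_tens_on_1:
  assumes "a \<in> tens_on S 1 n" "\<And>e. e \<in> S \<Longrightarrow> n = int (cdim e) - 1 \<Longrightarrow> g e \<in> spn U"
  shows "contr g a \<in> spn U"
  unfolding contr_def using assms(1)
  by (rule spn_lin) (auto elim!: words_1_E[unfolded One_nat_def] simp: assms(2))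

text \<open>A Kuenneth argument that contracts one factor at a time. The homotopy on the first
  factor replaces a cycle by \<open>x\<close> times a cycle with one letter less, up to a boundary;
  induction on the length treats the remaining letters.\<close>

lemma cycle_decomposition:
  assumes \<Phi>: "\<And>e. e \<in> S \<Longrightarrow> \<Phi> e \<in> tens_on S 1 (int (cdim e) - 2)"
    and h: "\<And>e. e \<in> S \<Longrightarrow> h e \<in> tens_on S 1 (int (cdim e))"
    and x: "x \<in> tens_on S 1 (- 1)" and Dx: "D \<Phi> x = 0"
    and \<epsilon>: "\<And>e. e \<in> S \<Longrightarrow> \<epsilon> e \<noteq> 0 \<Longrightarrow> cdim e = 0"
    and \<epsilon>\<Phi>: "\<And>e. e \<in> S \<Longrightarrow> contr (\<lambda>f. scal (\<epsilon> f)) (\<Phi> e) = 0"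
    and htp: "\<And>e. e \<in> S \<Longrightarrow> D \<Phi> (h e) + contr h (\<Phi> e) = mon [e] - scal (\<epsilon> e) * x"
    and "a \<in> tens_on S k n" "D \<Phi> a = 0"
  shows "\<exists>c w. a = scal c * x ^ k + D \<Phi> w \<and> w \<in> tens_on S k (n + 1)"
  using assms(8,9)
proof (induction k arbitrary: a n)
  case 0
  from 0(1) have "\<exists>c. a = scal c"
  proof (induction rule: spn_induct)
    case (mon u)
    then have "mon u = (1 :: 'c ta)" by (simp add: words_def)
    then show ?case by (metis scal_1)
  next
    case zero
    show ?case by (metis scal_0)
  next
    case (add a b)
    then show ?case by (metis scal_add)
  next
    case (scal q a)
    then show ?case by (metis scal_mult)
  qed
  then obtain c where "a = scal c * x ^ 0 + D \<Phi> 0"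
    by (auto simp: D_linear)
  then show ?case using spn_zero by blast
next
  case (Suc k)
  let ?H = "contr h" and ?K = "contr (\<lambda>f. scal (\<epsilon> f))"
  have sgl: "is_linear f \<Longrightarrow> f (sg l * b) = sg l * f b" for f :: "'c ta \<Rightarrow> 'c ta" and l b
    by (simp add: sg_def is_linearD)
  have words_Suc: "\<exists>e w. u = e # w \<and> e \<in> S \<and> w \<in> words S k (n + 1 - int (cdim e))"
    if "u \<in> words S (Suc k) n" for u n
    using that by (auto simp: words_def length_Suc_conv deg_Cons)
  have De: "D \<Phi> (mon (e # w)) = \<Phi> e * mon w + sg (int (cdim e) - 1) * (mon [e] * D \<Phi> (mon w))" for e w
    by (simp add: D_def)
  have e1: "mon [e] \<in> tens_on S 1 (int (cdim e) - 1)" if "e \<in> S" for e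
    using that by (intro tens_on_gen) simp_all
  \<comment> \<open>\<open>h\<close> raises the degree by one, so the two terms in which
    \<open>D\<close> acts on the tail have opposite signs and cancel. What remains is
    \<open>htp\<close> on the first letter.\<close>
  have "D \<Phi> (?H a) + ?H (D \<Phi> a) = a - x * ?K a"
  proof (rule spn_eqI[OF Suc.prems(1)])
    fix u assume "u \<in> words S (Suc k) n"
    then obtain e w where u: "u = e # w" "e \<in> S" using words_Suc by blast
    have "D \<Phi> (?H (mon u)) = D \<Phi> (h e) * mon w + sg (int (cdim e)) * (h e * D \<Phi> (mon w))"
      using u tens_on_hdeg[OF h[OF u(2)]] by (simp add: D_mult)
    moreover have "?H (D \<Phi> (mon u)) = ?H (\<Phi> e) * mon w + sg (int (cdim e) - 1) * (h e * D \<Phi> (mon w))"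
      using u by (simp add: De contr_linear sgl[OF is_linear_contr] contr_mult[OF \<Phi>] contr_mult[OF e1])
    ultimately have "D \<Phi> (?H (mon u)) + ?H (D \<Phi> (mon u)) = (D \<Phi> (h e) + ?H (\<Phi> e)) * mon w"
      by (simp add: sg_def algebra_simps)
    also have "\<dots> = mon u - x * ?K (mon u)"
      using u by (simp add: htp left_diff_distrib scal_left_commute mult.assoc mon_append[of "[e]" w, simplified, symmetric])
    finally show "D \<Phi> (?H (mon u)) + ?H (D \<Phi> (mon u)) = mon u - x * ?K (mon u)" .
  qed (intro is_linear_intros is_linear_contr is_linear_D is_linear_comp[OF is_linear_contr is_linear_D]
      is_linear_comp[OF is_linear_D is_linear_contr])+
  with Suc.prems have a: "a = x * ?K a + D \<Phi> (?H a)"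
    by (simp add: contr_linear)
  \<comment> \<open>\<open>?K\<close> deletes a letter with nonzero \<open>\<epsilon>\<close>, that
    is a vertex, of degree -1; hence the minus sign. Boundaries of the first letter disappear by
    \<open>\<epsilon>\<Phi>\<close>.\<close>
  have "?K (D \<Phi> a) = - D \<Phi> (?K a)"
  proof (rule spn_eqI[OF Suc.prems(1)])
    fix u assume "u \<in> words S (Suc k) n"
    then obtain e w where u: "u = e # w" "e \<in> S" using words_Suc by blast
    have "?K (D \<Phi> (mon u)) = sg (int (cdim e) - 1) * (scal (\<epsilon> e) * D \<Phi> (mon w))"
      using u by (simp add: De contr_linear sgl[OF is_linear_contr] contr_mult[OF \<Phi>] contr_mult[OF e1] \<epsilon>\<Phi>)
    also have "\<dots> = - D \<Phi> (?K (mon u))"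
      using \<epsilon>[of e] u by (cases "\<epsilon> e = 0") (simp_all add: D_linear sg_def)
    finally show "?K (D \<Phi> (mon u)) = - D \<Phi> (?K (mon u))" .
  qed (intro is_linear_intros is_linear_comp[OF is_linear_contr is_linear_D]
      is_linear_comp[OF is_linear_D is_linear_contr])+
  with Suc.prems have "D \<Phi> (?K a) = 0"
    by (simp add: contr_linear)
  moreover have "?K a \<in> tens_on S k (n + 1)"
    unfolding contr_def using Suc.prems(1)
  proof (rule spn_lin)
    fix u assume "u \<in> words S (Suc k) n"
    then obtain e w where u: "u = e # w" "e \<in> S" "w \<in> words S k (n + 1 - int (cdim e))"
      using words_Suc by blast
    then show "(case u of [] \<Rightarrow> 0 | e # v \<Rightarrow> scal (\<epsilon> e) * mon v) \<in> tens_on S k (n + 1)"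
      using \<epsilon>[of e] by (cases "\<epsilon> e = 0") (auto intro!: spn_scal spn_mon)
  qed
  ultimately obtain c w where w: "?K a = scal c * x ^ k + D \<Phi> w" "w \<in> tens_on S k (n + 1 + 1)"
    using Suc.IH by blast
  \<comment> \<open>Since \<open>x\<close> is an odd cycle, multiplying the shorter decomposition by
    \<open>x\<close> turns its boundary term into the boundary of \<open>- x * w\<close>.\<close>
  have "D \<Phi> (x * w) = - (x * D \<Phi> w)"
    by (simp add: D_mult[OF tens_on_hdeg[OF x]] Dx sg_def)
  then have "a = scal c * x ^ Suc k + D \<Phi> (?H a - x * w)"
    by (subst a) (simp add: w D_linear distrib_left scal_left_commute)
  moreover have "?H a \<in> tens_on S (Suc k) (n + 1)"
    unfolding contr_def using Suc.prems(1)
  proof (rule spn_lin)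
    fix u assume "u \<in> words S (Suc k) n"
    then obtain e w where u: "u = e # w" "e \<in> S" "w \<in> words S k (n + 1 - int (cdim e))"
      using words_Suc by blast
    then show "(case u of [] \<Rightarrow> 0 | e # v \<Rightarrow> h e * mon v) \<in> tens_on S (Suc k) (n + 1)"
      using tens_on_mult[OF h spn_mon, of e w k "n + 1 - int (cdim e)"] by simp
  qed
  moreover have "x * w \<in> tens_on S (Suc k) (n + 1)"
    using tens_on_mult[OF x w(2)] by (simp add: add.commute)
  ultimately show ?case by (blast intro: spn_diff)
qed

text \<open>Homology of a point over a field gives a chain equivalence with a point:
  \<open>\<epsilon>\<close> is the class of a vertex in units of \<open>x\<close>, and
  \<open>h\<close> is a homotopy from the identity to the projection onto \<open>x\<close>. Vertices
  have degree -1, so positive dimension is degree at least 0.\<close>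

lemma chain_contraction:
  assumes \<Phi>: "\<And>e. e \<in> S \<Longrightarrow> \<Phi> e \<in> tens_on S 1 (int (cdim e) - 2)"
    and DD: "\<And>e. e \<in> S \<Longrightarrow> D \<Phi> (\<Phi> e) = 0"
    and acyc: "\<And>n z. n \<ge> 0 \<Longrightarrow> z \<in> tens_on S 1 n \<Longrightarrow> D \<Phi> z = 0 \<Longrightarrow> \<exists>w\<in>tens_on S 1 (n + 1). D \<Phi> w = z"
    and x: "x \<in> tens_on S 1 (- 1)" and x_nb: "\<not> (\<exists>w\<in>tens_on S 1 0. D \<Phi> w = x)"
    and aug: "\<And>z. z \<in> tens_on S 1 (- 1) \<Longrightarrow> \<exists>q. \<exists>w\<in>tens_on S 1 0. z = scal q * x + D \<Phi> w"
  obtains h \<epsilon> where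
    "\<And>e. e \<in> S \<Longrightarrow> h e \<in> tens_on S 1 (int (cdim e))"
    "\<And>e. e \<in> S \<Longrightarrow> \<epsilon> e \<noteq> 0 \<Longrightarrow> cdim e = 0"
    "\<And>e. e \<in> S \<Longrightarrow> contr (\<lambda>f. scal (\<epsilon> f)) (\<Phi> e) = 0"
    "\<And>e. e \<in> S \<Longrightarrow> D \<Phi> (h e) + contr h (\<Phi> e) = mon [e] - scal (\<epsilon> e) * x"
proof -
  have "\<exists>q. if cdim e = 0 then \<exists>w\<in>tens_on S 1 0. mon [e] = scal q * x + D \<Phi> w else q = 0" if "e \<in> S" for e
    using that aug[of "mon [e]"] tens_on_gen[of e S "- 1"] by (cases "cdim e = 0") auto
  then obtain \<epsilon> where \<epsilon>: "\<And>e. e \<in> S \<Longrightarrow>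
      if cdim e = 0 then \<exists>w\<in>tens_on S 1 0. mon [e] = scal (\<epsilon> e) * x + D \<Phi> w else \<epsilon> e = 0"
    by metis
  let ?K = "contr (\<lambda>f. scal (\<epsilon> f))"
  have K: "\<exists>c. \<exists>w\<in>tens_on S 1 0. ?K a = scal c \<and> a = scal c * x + D \<Phi> w" if "a \<in> tens_on S 1 (- 1)" for a
    using that
  proof (induction rule: spn_induct)
    case (mon u)
    then obtain e where "u = [e]" "e \<in> S" "cdim e = 0"
      by (elim words_1_E) auto
    then show ?case using \<epsilon>[of e] by auto
  next
    case zero
    show ?case by (intro exI[of _ 0] bexI[of _ 0]) (simp_all add: contr_linear D_linear)
  next
    case (add a b)
    then obtain c w d v where "w \<in> tens_on S 1 0" and a: "?K a = scal c" "a = scal c * x + D \<Phi> w"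
      and "v \<in> tens_on S 1 0" and b: "?K b = scal d" "b = scal d * x + D \<Phi> v" by blast
    have 1: "?K (a + b) = scal (c + d)"
      by (simp only: contr_linear a(1) b(1) scal_add)
    have 2: "a + b = scal (c + d) * x + D \<Phi> (w + v)"
      by (subst a(2), subst b(2)) (simp add: D_linear scal_add distrib_right)
    from 1 2 \<open>w \<in> tens_on S 1 0\<close> \<open>v \<in> tens_on S 1 0\<close> show ?case
      by (blast intro: spn_add)
  next
    case (scal q a)
    then obtain c w where "w \<in> tens_on S 1 0" and a: "?K a = scal c" "a = scal c * x + D \<Phi> w" by blast
    have 1: "?K (scal q * a) = scal (q * c)"
      by (simp only: contr_linear a(1) scal_mult)
    have 2: "scal q * a = scal (q * c) * x + D \<Phi> (scal q * w)"
      by (subst a(2)) (simp add: D_linear scal_mult distrib_left mult.assoc)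
    from 1 2 \<open>w \<in> tens_on S 1 0\<close> show ?case
      by (blast intro: spn_scal)
  qed
  have K\<Phi>: "?K (\<Phi> e) = 0" if e: "e \<in> S" for e
  proof (cases "cdim e = 1")
    case True
    then obtain c w where w: "w \<in> tens_on S 1 0" "?K (\<Phi> e) = scal c" "\<Phi> e = scal c * x + D \<Phi> w"
      using K[of "\<Phi> e"] \<Phi>[OF e] by auto
    have "c = 0"
    proof (rule ccontr)
      assume "c \<noteq> 0"
      \<comment> \<open>For an edge \<open>e\<close>, \<Phi> e = c x + D w says that the boundary of
        \<open>e - w\<close> is c x. With c invertible, \<open>x\<close> itself would bound.\<close>
      let ?w = "scal (1 / c) * (mon [e] - w)"
      have "?w \<in> tens_on S 1 0"
        using w True e by (intro spn_scal spn_diff tens_on_gen) simp_all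
      moreover have "D \<Phi> ?w = scal (1 / c) * (scal c * x)"
        using w(3) by (simp add: D_linear D_gen)
      then have "D \<Phi> ?w = x"
        using \<open>c \<noteq> 0\<close> by (simp add: mult.assoc[symmetric] scal_mult[symmetric])
      ultimately show False using x_nb by blast
    qed
    with w show ?thesis by simp
  next
    case False
    have "?K (\<Phi> e) = (\<lambda>a. 0) (\<Phi> e)"
    proof (rule tens_on_1_eqI[OF \<Phi>[OF e] is_linear_contr is_linear_zero])
      fix f assume "f \<in> S" "int (cdim e) - 2 = int (cdim f) - 1"
      then show "?K (mon [f]) = 0" using False \<epsilon>[of f] by (auto split: if_splits)
    qed
    then show ?thesis .
  qed
  have lower: "cdim f < cdim e" if "int (cdim e) - 2 = int (cdim f) - 1" for e f
    using that by simp
  \<comment> \<open>Recursion on dimension: the condition on \<open>h e\<close> involves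
    \<open>h\<close> otherwise only on the cells of \<Phi> e, which are one dimension lower.\<close>
  have "\<exists>h. \<forall>e. e \<in> S \<longrightarrow> h e \<in> tens_on S 1 (int (cdim e)) \<and> D \<Phi> (h e) + contr h (\<Phi> e) = mon [e] - scal (\<epsilon> e) * x"
  proof (rule dependent_wf_choice[OF wf_measure[of cdim], where
        P = "\<lambda>h e r. e \<in> S \<longrightarrow> r \<in> tens_on S 1 (int (cdim e)) \<and> D \<Phi> r + contr h (\<Phi> e) = mon [e] - scal (\<epsilon> e) * x"])
    fix h g :: "'c \<Rightarrow> 'c ta" and e r
    assume hg: "\<And>f. (f, e) \<in> measure cdim \<Longrightarrow> h f = g f"
    have "contr h (\<Phi> e) = contr g (\<Phi> e)" if "e \<in> S"
      by (rule tens_on_1_eqI[OF \<Phi>[OF that] is_linear_contr is_linear_contr]) (simp add: hg)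
    then show "(e \<in> S \<longrightarrow> r \<in> tens_on S 1 (int (cdim e)) \<and> D \<Phi> r + contr h (\<Phi> e) = mon [e] - scal (\<epsilon> e) * x) =
       (e \<in> S \<longrightarrow> r \<in> tens_on S 1 (int (cdim e)) \<and> D \<Phi> r + contr g (\<Phi> e) = mon [e] - scal (\<epsilon> e) * x)"
      by auto
  next
    fix e and h :: "'c \<Rightarrow> 'c ta"
    assume IH: "\<And>f. (f, e) \<in> measure cdim \<Longrightarrow> f \<in> S \<longrightarrow> h f \<in> tens_on S 1 (int (cdim f)) \<and>
      D \<Phi> (h f) + contr h (\<Phi> f) = mon [f] - scal (\<epsilon> f) * x"
    have "\<exists>r. r \<in> tens_on S 1 (int (cdim e)) \<and> D \<Phi> r + contr h (\<Phi> e) = mon [e] - scal (\<epsilon> e) * x" if e: "e \<in> S"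
    proof (cases "cdim e = 0")
      case True
      \<comment> \<open>For a vertex there is no boundary term, and the chain that exhibits the
        value of \<open>\<epsilon> e\<close> is already the required \<open>h e\<close>.\<close>
      then have "\<Phi> e = 0"
        by (intro tens_on_1_trivial[OF \<Phi>[OF e]]) simp
      then show ?thesis
        using \<epsilon>[OF e] True by (auto simp: contr_linear)
    next
      case False
      let ?y = "mon [e] - contr h (\<Phi> e)"
      \<comment> \<open>The homotopy identity holds on each face by induction, hence on \<Phi> e by
        linearity. As \<Phi> e is a cycle with zero augmentation, \<open>?y\<close> is a cycle and
        acyclicity yields \<open>h e\<close>.\<close>
      have "D \<Phi> (contr h (\<Phi> e)) + contr h (D \<Phi> (\<Phi> e)) = \<Phi> e - x * ?K (\<Phi> e)"
      proof (rule tens_on_1_eqI[OF \<Phi>[OF e]])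
        fix f assume f: "f \<in> S" "int (cdim e) - 2 = int (cdim f) - 1"
        then show "D \<Phi> (contr h (mon [f])) + contr h (D \<Phi> (mon [f])) = mon [f] - x * ?K (mon [f])"
          using IH[of f] lower[OF f(2)] by (simp add: D_gen scal_commute)
      qed (intro is_linear_intros is_linear_contr is_linear_D is_linear_comp[OF is_linear_contr is_linear_D]
          is_linear_comp[OF is_linear_D is_linear_contr])+
      then have "D \<Phi> ?y = 0"
        by (simp add: DD K\<Phi> e contr_linear D_linear D_gen)
      moreover have "contr h (\<Phi> e) \<in> tens_on S 1 (int (cdim e) - 1)"
      proof (rule contr_tens_on_1[OF \<Phi>[OF e]])
        fix f assume f: "f \<in> S" "int (cdim e) - 2 = int (cdim f) - 1"
        then have "int (cdim f) = int (cdim e) - 1" by simp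
        then show "h f \<in> tens_on S 1 (int (cdim e) - 1)"
          using IH[of f] f lower[OF f(2)] by simp
      qed
      then have "?y \<in> tens_on S 1 (int (cdim e) - 1)"
        using e by (intro spn_diff tens_on_gen) simp_all
      ultimately obtain r where "r \<in> tens_on S 1 (int (cdim e))" "D \<Phi> r = ?y"
        using acyc[of "int (cdim e) - 1" ?y] False by auto
      then show ?thesis
        using \<epsilon>[OF e] False by auto
    qed
    then show "\<exists>r. e \<in> S \<longrightarrow> r \<in> tens_on S 1 (int (cdim e)) \<and> D \<Phi> r + contr h (\<Phi> e) = mon [e] - scal (\<epsilon> e) * x"
      by blast
  qed
  then obtain h where "\<And>e. e \<in> S \<Longrightarrow> h e \<in> tens_on S 1 (int (cdim e))"
    "\<And>e. e \<in> S \<Longrightarrow> D \<Phi> (h e) + contr h (\<Phi> e) = mon [e] - scal (\<epsilon> e) * x" by blast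
  moreover have "cdim e = 0" if "e \<in> S" "\<epsilon> e \<noteq> 0" for e
    using \<epsilon>[OF that(1)] that(2) by (auto split: if_splits)
  ultimately show ?thesis using K\<Phi> that by blast
qed

text \<open>The decomposition yields only a tensor \<open>w\<close>, not a Lie element. Applying
  \<open>dynkin\<close> to it gives \<open>k\<close> times \<open>z\<close> as a boundary of a Lie
  element, and dividing by \<open>k\<close> finishes.\<close>

theorem lie_hom_acyclic:
  assumes \<Phi>: "\<And>e. e \<in> S \<Longrightarrow> \<Phi> e \<in> tens_on S 1 (int (cdim e) - 2)"
    and \<Phi>U: "\<And>e. \<Phi> e \<in> tens_on UNIV 1 (int (cdim e) - 2)"
    and DD: "\<And>e. e \<in> S \<Longrightarrow> D \<Phi> (\<Phi> e) = 0"
    and acyc: "\<And>n z. n \<ge> 0 \<Longrightarrow> z \<in> tens_on S 1 n \<Longrightarrow> D \<Phi> z = 0 \<Longrightarrow> \<exists>w\<in>tens_on S 1 (n + 1). D \<Phi> w = z"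
    and x: "x \<in> tens_on S 1 (- 1)" and x_nb: "\<not> (\<exists>w\<in>tens_on S 1 0. D \<Phi> w = x)"
    and aug: "\<And>z. z \<in> tens_on S 1 (- 1) \<Longrightarrow> \<exists>q. \<exists>w\<in>tens_on S 1 0. z = scal q * x + D \<Phi> w"
    and z: "lie_hom S k n z" "D \<Phi> z = 0" and k: "k \<ge> 3"
  shows "\<exists>w. lie_hom S k (n + 1) w \<and> D \<Phi> w = z"
proof -
  obtain h \<epsilon> where h\<epsilon>:
    "\<And>e. e \<in> S \<Longrightarrow> h e \<in> tens_on S 1 (int (cdim e))"
    "\<And>e. e \<in> S \<Longrightarrow> \<epsilon> e \<noteq> 0 \<Longrightarrow> cdim e = 0"
    "\<And>e. e \<in> S \<Longrightarrow> contr (\<lambda>f. scal (\<epsilon> f)) (\<Phi> e) = 0"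
    "\<And>e. e \<in> S \<Longrightarrow> D \<Phi> (h e) + contr h (\<Phi> e) = mon [e] - scal (\<epsilon> e) * x"
    using chain_contraction[OF \<Phi> DD acyc x x_nb aug] by blast
  have Dx: "D \<Phi> x = 0"
    using D_tens_on[OF \<Phi> x] by (rule tens_on_1_trivial) simp_all
  obtain c w where w: "z = scal c * x ^ k + D \<Phi> w" "w \<in> tens_on S k (n + 1)"
    using cycle_decomposition[OF \<Phi> h\<epsilon>(1) x Dx h\<epsilon>(2-4) lie_hom_tens_on[OF z(1)] z(2)] by blast
  have "scal (of_nat k) * z = D \<Phi> (dynkin w)"
    using dynkin_specht_wever[OF z(1)] dynkin_power[OF x k] by (simp add: w dynkin_linear dynkin_D[OF \<Phi>U])
  then have "D \<Phi> (scal (1 / of_nat k) * dynkin w) = scal (1 / of_nat k) * (scal (of_nat k) * z)"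
    by (simp add: D_linear)
  also have "\<dots> = z"
    using k by (simp add: mult.assoc[symmetric] scal_mult[symmetric])
  finally show ?thesis
    using lie_hom_dynkin[OF w(2)] lie_hom.scal by blast
qed

section \<open>Obstruction theory\<close>

text \<open>The part of total index \<open>m\<close> in the square of the total derivation. It sends
  generators to length \<open>m - 1\<close>, so the unknown of length \<open>k\<close> is governed
  by \<open>m = k + 1\<close>.\<close>

definition obs :: "(nat \<Rightarrow> 'c \<Rightarrow> 'c ta) \<Rightarrow> nat \<Rightarrow> 'c ta \<Rightarrow> 'c ta" where
  "obs \<delta> m a = (\<Sum>i\<in>{1..m-1}. D (\<delta> i) (D (\<delta> (m - i)) a))"

lemma is_linear_obs: "is_linear (obs \<delta> m)"
  unfolding obs_def by (intro is_linear_sum is_linear_comp[OF is_linear_D is_linear_D])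

lemma obs_cong:
  assumes "\<And>i. 1 \<le> i \<Longrightarrow> i < m \<Longrightarrow> \<delta> i = \<delta>' i"
  shows "obs \<delta> m = obs \<delta>' m"
  unfolding obs_def by (intro ext sum.cong) (auto simp: assms)

text \<open>The mixed terms \<open>D\<^sub>i a \<cdot> D\<^sub>j b\<close> cancel under \<open>i \<leftrightarrow> j\<close>, so \<open>obs \<delta> m\<close> is an even derivation.\<close>

lemma obs_mult:
  assumes odd: "\<And>i. 1 \<le> i \<Longrightarrow> i < m \<Longrightarrow> odd_map (\<delta> i)" and a: "a \<in> hdeg n"
  shows "obs \<delta> m (a * b) = obs \<delta> m a * b + a * obs \<delta> m b"
proof -
  have "D (\<delta> i) (D (\<delta> (m - i)) (a * b)) =
      D (\<delta> i) (D (\<delta> (m - i)) a) * b + a * D (\<delta> i) (D (\<delta> (m - i)) b)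
      + sg n * (D (\<delta> i) a * D (\<delta> (m - i)) b) - sg n * (D (\<delta> (m - i)) a * D (\<delta> i) b)"
    if "i \<in> {1..m-1}" for i
  proof -
    have "D (\<delta> (m - i)) a \<in> hdeg (n - 1)"
      using that by (intro D_hdeg odd a) auto
    moreover have "D (\<delta> i) (sg n * c) = sg n * D (\<delta> i) c" for c
      by (simp add: sg_def D_linear)
    ultimately show ?thesis
      by (simp add: D_mult[OF a] D_linear D_mult[of "D (\<delta> (m - i)) a"])
        (simp add: sg_def)
  qed
  then have "obs \<delta> m (a * b) = (\<Sum>i\<in>{1..m-1}. D (\<delta> i) (D (\<delta> (m - i)) a) * b + a * D (\<delta> i) (D (\<delta> (m - i)) b)
      + sg n * (D (\<delta> i) a * D (\<delta> (m - i)) b) - sg n * (D (\<delta> (m - i)) a * D (\<delta> i) b))"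
    unfolding obs_def by (intro sum.cong) auto
  also have "\<dots> = obs \<delta> m a * b + a * obs \<delta> m b
     + (\<Sum>i\<in>{1..m-1}. sg n * (D (\<delta> i) a * D (\<delta> (m - i)) b))
     - (\<Sum>i\<in>{1..m-1}. sg n * (D (\<delta> (m - i)) a * D (\<delta> i) b))"
    by (simp add: obs_def sum.distrib sum_subtractf sum_distrib_left sum_distrib_right)
  also have "(\<Sum>i\<in>{1..m-1}. sg n * (D (\<delta> (m - i)) a * D (\<delta> i) b))
      = (\<Sum>i\<in>{1..m-1}. sg n * (D (\<delta> i) a * D (\<delta> (m - i)) b))"
    by (rule sum.reindex_bij_witness[of _ "\<lambda>i. m - i" "\<lambda>i. m - i"]) auto
  finally show ?thesis by simp
qed

lemma obs_eq_0I:
  assumes odd: "\<And>i. 1 \<le> i \<Longrightarrow> i < m \<Longrightarrow> odd_map (\<delta> i)" and gen: "\<And>e. obs \<delta> m (mon [e]) = 0"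
  shows "obs \<delta> m a = 0"
proof -
  have "obs \<delta> m (mon u) = 0" for u
  proof (induction u)
    case (Cons e u)
    have "mon (e # u) = mon [e] * mon u"
      using mon_append[of "[e]" u] by simp
    then show ?case
      using Cons gen obs_mult[of m \<delta> "mon [e]" "deg [e]" "mon u", OF odd hdeg_mon] by simp
  qed (simp add: obs_def D_linear)
  then have "obs \<delta> m a = (\<lambda>a. 0) a"
    by - (rule is_linear_eqI[OF subset_UNIV is_linear_obs is_linear_zero], simp)
  then show ?thesis .
qed

text \<open>The Bianchi identity: compare the terms of total index \<open>k + 2\<close> in \<open>\<delta> (\<delta>\<^sup>2) = (\<delta>\<^sup>2) \<delta>\<close>.\<close>

lemma obs_commute:
  assumes "k \<ge> 1" and van: "\<And>m a. m \<le> k \<Longrightarrow> obs \<delta> m a = 0"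
  shows "D (\<delta> 1) (obs \<delta> (k + 1) a) = obs \<delta> (k + 1) (D (\<delta> 1) a)"
proof -
  let ?A = "Sigma {1..k} (\<lambda>i. {1..k + 1 - i})"
  have split: "{1..k} = insert 1 {2..k}"
    using assms(1) by auto
  have "(\<Sum>i\<in>{1..k}. D (\<delta> i) (obs \<delta> (k + 2 - i) a)) =
      (\<Sum>(i, j)\<in>?A. D (\<delta> i) (D (\<delta> j) (D (\<delta> (k + 2 - i - j)) a)))"
    by (simp add: obs_def D_linear sum.Sigma)
  \<comment> \<open>Both sums run over triples of positive indices with sum \<open>k + 2\<close>;
    the bijection rotates the triple cyclically.\<close>
  also have "\<dots> = (\<Sum>(i, j)\<in>?A. D (\<delta> j) (D (\<delta> (k + 2 - i - j)) (D (\<delta> i) a)))"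
    by (rule sum.reindex_bij_witness[of _ "\<lambda>(i, j). (j, k + 2 - i - j)" "\<lambda>(i, j). (k + 2 - i - j, i)"]) auto
  also have "\<dots> = (\<Sum>i\<in>{1..k}. obs \<delta> (k + 2 - i) (D (\<delta> i) a))"
    by (simp add: obs_def sum.Sigma)
  finally have "(\<Sum>i\<in>{1..k}. D (\<delta> i) (obs \<delta> (k + 2 - i) a)) = (\<Sum>i\<in>{1..k}. obs \<delta> (k + 2 - i) (D (\<delta> i) a))" .
  moreover have "obs \<delta> (k + 2 - i) b = 0" if "i \<in> {2..k}" for i b
    using that by (intro van) auto
  ultimately show ?thesis
    unfolding split by (simp add: D_linear)
qed

lemma D_zero_map [simp]: "D (\<lambda>e. 0) a = 0"
proof -
  have "dmon (\<lambda>e. 0) u = 0" for u :: "'c list"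
    by (induction u) simp_all
  then show ?thesis by (simp add: D_def lin_def)
qed

text \<open>Index \<open>k\<close> meets total index \<open>k + 1\<close> only when paired with
  index 1, on either side; \<open>k \<ge> 2\<close> keeps these two terms distinct. So the equation
  is affine in the unknown.\<close>

lemma obs_update:
  assumes "k \<ge> 2"
  shows "obs (\<delta>(k := \<psi>)) (k + 1) a =
    obs (\<delta>(k := \<lambda>e. 0)) (k + 1) a + D (\<delta> 1) (D \<psi> a) + D \<psi> (D (\<delta> 1) a)"
proof -
  have split: "{1..k + 1 - 1} = insert 1 (insert k {2..k - 1})"
    using assms by auto
  have "(\<Sum>i\<in>{2..k-1}. D ((\<delta>(k := \<psi>)) i) (D ((\<delta>(k := \<psi>)) (k + 1 - i)) a)) =
      (\<Sum>i\<in>{2..k-1}. D ((\<delta>(k := \<lambda>e. 0)) i) (D ((\<delta>(k := \<lambda>e. 0)) (k + 1 - i)) a))"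
    by (intro sum.cong) auto
  then show ?thesis
    unfolding obs_def split using assms by (simp add: D_linear)
qed

section \<open>Local maps and their inductive construction\<close>

definition local_lie :: "('c \<Rightarrow> 'c set) \<Rightarrow> nat \<Rightarrow> ('c \<Rightarrow> 'c ta) \<Rightarrow> bool" where
  "local_lie cl k \<Phi> \<longleftrightarrow> (\<forall>e. lie_hom (cl e) k (int (cdim e) - 2) (\<Phi> e))"

lemma local_lie_odd: "local_lie cl k \<Phi> \<Longrightarrow> odd_map \<Phi>"
  by (auto simp: local_lie_def odd_map_def intro: lie_hom_hdeg)

lemma local_lie_on_closure:
  assumes "local_lie cl k \<Phi>" "\<And>f. f \<in> S \<Longrightarrow> cl f \<subseteq> S" "e \<in> S"
  shows "lie_hom S k (int (cdim e) - 2) (\<Phi> e)"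
  using assms by (auto simp: local_lie_def intro: lie_hom_mono)

lemma extend_one_step:
  assumes cl: "\<And>e. e \<in> cl e" "\<And>e f. f \<in> cl e \<Longrightarrow> cl f \<subseteq> cl e"
    and acyc: "\<And>e n z. lie_hom (cl e) k n z \<Longrightarrow> D (\<delta> 1) z = 0 \<Longrightarrow>
      \<exists>w. lie_hom (cl e) k (n + 1) w \<and> D (\<delta> 1) w = z"
    and loc: "\<And>i. 1 \<le> i \<Longrightarrow> i < k \<Longrightarrow> local_lie cl i (\<delta> i)"
    and van: "\<And>m a. m \<le> k \<Longrightarrow> obs \<delta> m a = 0" and k: "k \<ge> 2"
  shows "\<exists>\<psi>. local_lie cl k \<psi> \<and> (\<forall>e. obs (\<delta>(k := \<psi>)) (k + 1) (mon [e]) = 0)"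
proof -
  define \<Phi> where "\<Phi> = \<delta> 1"
  \<comment> \<open>Zero at index \<open>k\<close> makes \<open>Ob\<close> consist of known terms
    alone. The relations up to \<open>k\<close> do not see this index and survive the
    change.\<close>
  define \<delta>' where "\<delta>' = \<delta>(k := \<lambda>e. 0)"
  define Ob where "Ob = obs \<delta>' (k + 1)"
  have [simp]: "\<delta>' 1 = \<Phi>" "\<delta>' (Suc 0) = \<Phi>"
    using k by (simp_all add: \<delta>'_def \<Phi>_def)
  have loc': "local_lie cl i (\<delta>' i)" if "1 \<le> i" "i \<le> k" for i
    using loc[of i] that by (auto simp: \<delta>'_def local_lie_def lie_hom.zero)
  have van': "obs \<delta>' m a = 0" if "m \<le> k" for m a
    using van[OF that] that by (metis \<delta>'_def fun_upd_other le_less_trans less_irrefl not_less obs_cong)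
  have Ob_comm: "D \<Phi> (Ob a) = Ob (D \<Phi> a)" for a
    using obs_commute[of k \<delta>' a] van' k by (simp add: Ob_def)
  have \<Phi>: "\<Phi> e \<in> tens_on (cl e) 1 (int (cdim e) - 2)" for e
    using loc[of 1] k by (auto simp: \<Phi>_def local_lie_def intro: lie_hom_tens_on)
  have DD: "D \<Phi> (\<Phi> e) = 0" for e
    using van'[of 2 "mon [e]"] k by (simp add: obs_def D_gen)
  have Ob_lie: "lie_hom (cl e) k (int (cdim e) - 3) (Ob (mon [e]))" for e
    unfolding Ob_def obs_def
  proof (rule lie_hom_sum)
    fix i assume i: "i \<in> {1..k + 1 - 1}"
    have "lie_hom (cl e) (k + 1 - i + (i - 1)) (int (cdim e) - 2 - 1) (D (\<delta>' i) (\<delta>' (k + 1 - i) e))"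
    proof (rule lie_hom_D)
      show "odd_map (\<delta>' i)" using i loc' local_lie_odd by auto
      show "lie_hom (cl e) (k + 1 - i) (int (cdim e) - 2) (\<delta>' (k + 1 - i) e)"
        using i loc'[of "k + 1 - i"] by (auto simp: local_lie_def)
      show "lie_hom (cl e) (Suc (i - 1)) (int (cdim f) - 2) (\<delta>' i f)" if "f \<in> cl e" for f
        using i local_lie_on_closure[OF loc' cl(2), of i e f] that by auto
    qed
    then show "lie_hom (cl e) k (int (cdim e) - 3) (D (\<delta>' i) (D (\<delta>' (k + 1 - i)) (mon [e])))"
      using i by (simp add: D_gen)
  qed
  \<comment> \<open>The relation of index \<open>k + 1\<close> solved for
    \<open>D \<Phi> (\<psi> e)\<close>. The right-hand side uses \<open>\<psi>\<close> on faces
    only, which permits well-founded choice by dimension.\<close>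
  have "\<exists>\<psi>. \<forall>e. lie_hom (cl e) k (int (cdim e) - 2) (\<psi> e) \<and> D \<Phi> (\<psi> e) = - Ob (mon [e]) - D \<psi> (\<Phi> e)"
  proof (rule dependent_wf_choice[OF wf_measure[of cdim], where
      P = "\<lambda>\<psi> e r. lie_hom (cl e) k (int (cdim e) - 2) r \<and> D \<Phi> r = - Ob (mon [e]) - D \<psi> (\<Phi> e)"])
    fix \<psi> \<psi>' :: "'c \<Rightarrow> 'c ta" and e r
    assume eq: "\<And>f. (f, e) \<in> measure cdim \<Longrightarrow> \<psi> f = \<psi>' f"
    have "D \<psi> (\<Phi> e) = D \<psi>' (\<Phi> e)"
      by (rule tens_on_1_eqI[OF \<Phi> is_linear_D is_linear_D]) (simp add: D_gen eq)
    then show "(lie_hom (cl e) k (int (cdim e) - 2) r \<and> D \<Phi> r = - Ob (mon [e]) - D \<psi> (\<Phi> e)) =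
        (lie_hom (cl e) k (int (cdim e) - 2) r \<and> D \<Phi> r = - Ob (mon [e]) - D \<psi>' (\<Phi> e))"
      by simp
  next
    fix e and \<psi> :: "'c \<Rightarrow> 'c ta"
    assume IH: "\<And>f. (f, e) \<in> measure cdim \<Longrightarrow>
      lie_hom (cl f) k (int (cdim f) - 2) (\<psi> f) \<and> D \<Phi> (\<psi> f) = - Ob (mon [f]) - D \<psi> (\<Phi> f)"
    \<comment> \<open>The equations already solved on the faces, added up along \<Phi> e. With the
      square of \<open>D \<Phi>\<close> zero on \<open>e\<close> and \<open>Ob\<close> commuting
      with \<open>D \<Phi>\<close>, they make the new right-hand side a cycle.\<close>
    have "D \<Phi> (D \<psi> (\<Phi> e)) + D \<psi> (D \<Phi> (\<Phi> e)) = - Ob (\<Phi> e)"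
      by (rule tens_on_1_eqI[OF \<Phi>])
        (intro is_linear_intros is_linear_comp[OF is_linear_D is_linear_D] is_linear_obs[folded Ob_def]
         | use IH in \<open>simp add: D_gen Ob_def is_linear_obs\<close>)+
    then have "D \<Phi> (- Ob (mon [e]) - D \<psi> (\<Phi> e)) = 0"
      by (simp add: D_linear DD Ob_comm D_gen)
    moreover have "lie_hom (cl e) k (int (cdim e) - 3) (D \<psi> (\<Phi> e))"
      using \<Phi>[of e]
    proof (induction rule: spn_induct)
      case (mon u)
      then obtain f where f: "u = [f]" "f \<in> cl e" "int (cdim e) - 2 = int (cdim f) - 1"
        by (rule words_1_E)
      then have "int (cdim e) - 3 = int (cdim f) - 2" "cdim f < cdim e" by simp_all
      then show ?case
        using IH[of f] f cl(2)[of f e] by (auto simp: D_gen intro: lie_hom_mono)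
    qed (simp_all add: D_linear lie_hom.intros)
    then have "lie_hom (cl e) k (int (cdim e) - 3) (- Ob (mon [e]) - D \<psi> (\<Phi> e))"
      by (intro lie_hom_diff lie_hom_uminus Ob_lie)
    ultimately show "\<exists>r. lie_hom (cl e) k (int (cdim e) - 2) r \<and> D \<Phi> r = - Ob (mon [e]) - D \<psi> (\<Phi> e)"
      using acyc[of e "int (cdim e) - 3" "- Ob (mon [e]) - D \<psi> (\<Phi> e)"] by (simp add: \<Phi>_def)
  qed
  then obtain \<psi> where *: "\<forall>e. lie_hom (cl e) k (int (cdim e) - 2) (\<psi> e) \<and>
      D \<Phi> (\<psi> e) = - Ob (mon [e]) - D \<psi> (\<Phi> e)" ..
  note \<psi> = *[THEN spec, THEN conjunct1] *[THEN spec, THEN conjunct2]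
  have "obs (\<delta>(k := \<psi>)) (k + 1) (mon [e]) = 0" for e
  proof -
    have "obs (\<delta>(k := \<psi>)) (k + 1) (mon [e]) = Ob (mon [e]) + D \<Phi> (\<psi> e) + D \<psi> (\<Phi> e)"
      by (subst obs_update[OF k]) (simp only: D_gen Ob_def \<delta>'_def \<Phi>_def)
    also have "\<dots> = 0"
      by (simp only: \<psi>(2)) simp
    finally show ?thesis .
  qed
  moreover have "local_lie cl k \<psi>"
    unfolding local_lie_def using \<psi>(1) by (rule allI)
  ultimately show ?thesis by blast
qed

theorem extend_all:
  assumes cl: "\<And>e. e \<in> cl e" "\<And>e f. f \<in> cl e \<Longrightarrow> cl f \<subseteq> cl e"
    and acyc: "\<And>e k n z. k \<ge> 3 \<Longrightarrow> lie_hom (cl e) k n z \<Longrightarrow> D \<Phi> z = 0 \<Longrightarrow>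
      \<exists>w. lie_hom (cl e) k (n + 1) w \<and> D \<Phi> w = z"
    and \<Phi>: "local_lie cl 1 \<Phi>" and \<delta>2: "local_lie cl 2 \<delta>2"
    and sq: "\<And>e. D \<Phi> (\<Phi> e) = 0" and comm: "\<And>e. D \<Phi> (\<delta>2 e) + D \<delta>2 (\<Phi> e) = 0"
  shows "\<exists>\<delta>. \<delta> 1 = \<Phi> \<and> \<delta> 2 = \<delta>2 \<and> (\<forall>k\<ge>3. local_lie cl k (\<delta> k)) \<and> (\<forall>m a. obs \<delta> m a = 0)"
proof -
  \<comment> \<open>Choosing index \<open>k\<close> settles the relation of index
    \<open>k + 1\<close>, so vanishing of \<open>obs\<close> at \<open>m\<close> needs
    \<open>Q\<close> only below \<open>m\<close>. Index 0 is a free placeholder, since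
    \<open>obs\<close> starts at 1.\<close>
  define Q where "Q \<delta> k r \<longleftrightarrow> (if k = 0 then True else if k = 1 then r = \<Phi> else if k = 2 then r = \<delta>2
      else local_lie cl k r \<and> (\<forall>e. obs (\<delta>(k := r)) (k + 1) (mon [e]) = 0))" for \<delta> k r
  have Q_loc: "local_lie cl i r" if "Q \<delta> i r" "1 \<le> i" for \<delta> i r
    using that \<Phi> \<delta>2 by (auto simp: Q_def split: if_splits)
  have Q_obs: "obs \<delta> m a = 0" if Q: "\<And>i. i < m \<Longrightarrow> Q \<delta> i (\<delta> i)" for \<delta> m a
  proof (cases "m \<ge> 2")
    case True
    then have 1: "\<delta> 1 = \<Phi>" using Q[of 1] by (simp add: Q_def)
    have "obs \<delta> m (mon [e]) = 0" for e
    proof -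
      \<comment> \<open>Index 2 is the square of the boundary, index 3 the given commutation
        relation; from 4 on the relation was imposed when index \<open>m - 1\<close> was
        chosen.\<close>
      consider "m = 2" | "m = 3" | "m \<ge> 4" using True by linarith
      then show ?thesis
      proof cases
        case 1
        then show ?thesis using \<open>\<delta> 1 = \<Phi>\<close> sq by (simp add: obs_def D_gen)
      next
        case 2
        then have "\<delta> 2 = \<delta>2" using Q[of 2] by (simp add: Q_def)
        moreover have "{1..2::nat} = {1, 2}" by auto
        ultimately show ?thesis using 2 1 comm by (simp add: obs_def D_gen)
      next
        case 3
        then have "m - 1 \<noteq> 0" "m - 1 \<noteq> 1" "m - 1 \<noteq> 2" "m - 1 + 1 = m" by auto
        with 3 show ?thesis using Q[of "m - 1"] by (simp only: Q_def if_False fun_upd_triv)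
      qed
    qed
    moreover have "odd_map (\<delta> i)" if "1 \<le> i" "i < m" for i
      using Q_loc[OF Q] local_lie_odd that by blast
    ultimately show ?thesis by (rule obs_eq_0I[rotated])
  next
    case False
    then have "{1..m - 1} = {}" by auto
    then show ?thesis by (simp add: obs_def)
  qed
  have "\<exists>\<delta>. \<forall>k. Q \<delta> k (\<delta> k)"
  proof (rule dependent_wf_choice[OF wf_less])
    fix \<delta> \<delta>' :: "nat \<Rightarrow> 'c \<Rightarrow> 'c ta" and k :: nat and r
    assume "\<And>i. (i, k) \<in> {(x, y). x < y} \<Longrightarrow> \<delta> i = \<delta>' i"
    then have "obs (\<delta>(k := r)) (k + 1) = obs (\<delta>'(k := r)) (k + 1)"
      by (intro obs_cong) auto
    then show "Q \<delta> k r = Q \<delta>' k r" by (simp add: Q_def)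
  next
    fix k :: nat and \<delta> :: "nat \<Rightarrow> 'c \<Rightarrow> 'c ta"
    assume IH: "\<And>i. (i, k) \<in> {(x, y). x < y} \<Longrightarrow> Q \<delta> i (\<delta> i)"
    show "\<exists>r. Q \<delta> k r"
    proof (cases "k \<ge> 3")
      case True
      then have 1: "\<delta> 1 = \<Phi>" using IH[of 1] by (simp add: Q_def)
      have "\<exists>\<psi>. local_lie cl k \<psi> \<and> (\<forall>e. obs (\<delta>(k := \<psi>)) (k + 1) (mon [e]) = 0)"
      proof (rule extend_one_step[OF cl])
        show "\<exists>w. lie_hom (cl e) k (n + 1) w \<and> D (\<delta> 1) w = z"
          if "lie_hom (cl e) k n z" "D (\<delta> 1) z = 0" for e n z
          using acyc[OF True] that unfolding 1 by blast
        show "local_lie cl i (\<delta> i)" if "1 \<le> i" "i < k" for i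
          using IH[of i] Q_loc that by auto
        show "obs \<delta> m a = 0" if "m \<le> k" for m a
          using IH that by (intro Q_obs) auto
      qed (use True in auto)
      with True show ?thesis by (auto simp: Q_def)
    qed (auto simp: Q_def)
  qed
  then obtain \<delta> where \<delta>: "\<And>k. Q \<delta> k (\<delta> k)" by blast
  show ?thesis
  proof (intro exI[of _ \<delta>] conjI allI impI)
    show "\<delta> 1 = \<Phi>" "\<delta> 2 = \<delta>2" using \<delta>[of 1] \<delta>[of 2] by (simp_all add: Q_def)
    show "local_lie cl k (\<delta> k)" if "k \<ge> 3" for k using Q_loc[OF \<delta>] that by simp
    show "obs \<delta> m a = 0" for m a by (intro Q_obs \<delta>)
  qed
qed

section \<open>Tensors as coefficient functions\<close>

lemma ins_eq: "coeff (mon p * x * mon s) = ins p (coeff x) s"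
proof
  fix w
  have left: "coeff (mon p * y) v = (if take (length p) v = p then coeff y (drop (length p) v) else 0)"
    for y v
  proof -
    have "coeff (mon p * y) v = (\<Sum>i\<le>length v. if i = length p then
        (if take (length p) v = p then coeff y (drop (length p) v) else 0) else 0)"
      unfolding lookup_ta_mult by (intro sum.cong) (auto simp: lookup_single when_def)
    then show ?thesis by auto
  qed
  have right: "coeff (y * mon s) v =
      (if length s \<le> length v \<and> drop (length v - length s) v = s then coeff y (take (length v - length s) v) else 0)"
    for y v
  proof -
    have "coeff (y * mon s) v = (\<Sum>i\<le>length v. if i = length v - length s then
        (if length s \<le> length v \<and> drop (length v - length s) v = s then coeff y (take (length v - length s) v) else 0) else 0)"
      unfolding lookup_ta_mult by (intro sum.cong) (auto simp: lookup_single when_def)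
    then show ?thesis by auto
  qed
  show "coeff (mon p * x * mon s) w = ins p (coeff x) s w"
    unfolding ins_def right left
    by (auto simp: min_def split: if_splits)
qed

lemma coeff_sg: "coeff (sg n * a) w = sgn_of n * coeff a w"
  by (simp add: sg_def sgn_of_def)

lemma dmon_dword: "coeff (dmon \<Phi> u) = dword cdim (\<lambda>e. coeff (\<Phi> e)) u"
proof -
  have "dmon \<Phi> u = (\<Sum>i<length u. sg (deg (take i u)) * (mon (take i u) * \<Phi> (u ! i) * mon (drop (Suc i) u)))"
  proof (induction u)
    case (Cons e u)
    let ?t = "\<lambda>u i. sg (deg (take i u)) * (mon (take i u) * \<Phi> (u ! i) * mon (drop (Suc i) u))"
    have "mon (e # take i u) = mon [e] * mon (take i u)" for i
      using mon_append[of "[e]" "take i u"] by simp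
    then have "sg (int (cdim e) - 1) * (mon [e] * ?t u i) = ?t (e # u) (Suc i)" for i
      by (simp add: deg_Cons sg_def mult.assoc)
    then have "dmon \<Phi> (e # u) = ?t (e # u) 0 + (\<Sum>i<length u. ?t (e # u) (Suc i))"
      by (simp add: Cons sum_distrib_left sg_def)
    then show ?case
      by (simp only: sum.lessThan_Suc_shift length_Cons)
  qed simp
  then show ?thesis
    by (simp add: fun_eq_iff dword_def lookup_sum coeff_sg ins_eq)
qed

lemma coeff_D: "coeff (D \<Phi> a) = der cdim (\<lambda>e. coeff (\<Phi> e)) (coeff a)"
  by (simp add: fun_eq_iff D_def lin_def der_def lookup_sum dmon_dword in_keys_iff[symmetric])

lemma coeff_gen: "coeff (mon [e]) = gen e"
  by (auto simp: fun_eq_iff gen_def lookup_single when_def)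

lemma coeff_add: "coeff (a + b) = tadd (coeff a) (coeff b)"
  by (simp add: fun_eq_iff tadd_def lookup_add)

lemma coeff_scal: "coeff (scal q * a) = tsmult q (coeff a)"
  by (simp add: fun_eq_iff tsmult_def)

lemma coeff_zero: "coeff 0 = (\<lambda>_. 0)"
  by (simp add: fun_eq_iff)

text \<open>\<open>lie\<close> takes its sign from the two pieces of each cut. For homogeneous
  factors these have the degrees \<open>n\<close> and \<open>m\<close> wherever the swapped product
  contributes, so the sign is constant.\<close>

lemma coeff_brk:
  assumes a: "a \<in> hdeg m" and b: "b \<in> hdeg n"
  shows "coeff (brk m n a b) = lie cdim (coeff a) (coeff b)"
proof
  fix w
  have *: "sgn_of (m * n) * (coeff b (take i w) * coeff a (drop i w)) =
      sgn_of (deg (take i w) * deg (drop i w)) * coeff b (take i w) * coeff a (drop i w)" for i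
  proof (cases "coeff b (take i w) = 0 \<or> coeff a (drop i w) = 0")
    case False
    then have "deg (take i w) = n" "deg (drop i w) = m"
      using a b by (auto simp: spn_def in_keys_iff)
    then show ?thesis by (simp add: mult.commute mult.assoc)
  qed auto
  have "coeff (brk m n a b) w = coeff (a * b) w - sgn_of (m * n) * coeff (b * a) w"
    by (simp add: brk_def lookup_minus coeff_sg)
  then show "coeff (brk m n a b) w = lie cdim (coeff a) (coeff b) w"
    by (simp only: lookup_ta_mult lie_def sum_subtractf sum_distrib_left *)
qed

lemma lie_bilinear:
  "lie cdim (tadd a a') b = tadd (lie cdim a b) (lie cdim a' b)"
  "lie cdim a (tadd b b') = tadd (lie cdim a b) (lie cdim a b')"
  "lie cdim (tsmult q a) b = tsmult q (lie cdim a b)"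
  "lie cdim a (tsmult q b) = tsmult q (lie cdim a b)"
  "lie cdim (\<lambda>_. 0) b = (\<lambda>_. 0)" "lie cdim a (\<lambda>_. 0) = (\<lambda>_. 0)"
  by (simp_all add: fun_eq_iff lie_def tadd_def tsmult_def sum.distrib[symmetric] sum_distrib_left algebra_simps)

lemma lie_hom_lie_len: "lie_hom S k n a \<Longrightarrow> lie_len cdim S k (coeff a)"
proof (induction rule: lie_hom.induct)
  case (gen e n)
  then show ?case using ll_gen[of e S cdim] by (simp add: coeff_gen)
next
  case (brk i m a j n b)
  then show ?case using ll_lie[of cdim S i "coeff a" j "coeff b"]
    by (simp add: coeff_brk[OF lie_hom_hdeg lie_hom_hdeg])
qed (simp_all add: coeff_zero coeff_add coeff_scal lie_len.intros)

text \<open>\<open>lie_len\<close> permits sums of different degrees, and such elements enter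
  brackets again. Finite sums of homogeneous Lie elements are the class of tensors that absorbs
  this.\<close>

inductive lie_sum :: "'c set \<Rightarrow> nat \<Rightarrow> 'c ta \<Rightarrow> bool" for S k where
  hom: "lie_hom S k n a \<Longrightarrow> lie_sum S k a"
| add: "lie_sum S k a \<Longrightarrow> lie_sum S k b \<Longrightarrow> lie_sum S k (a + b)"

lemma lie_sum_scal: "lie_sum S k a \<Longrightarrow> lie_sum S k (scal q * a)"
  by (induction rule: lie_sum.induct) (auto simp: distrib_left intro: lie_sum.intros lie_hom.scal)

lemma lie_sum_lie:
  assumes "lie_sum S i a" "lie_sum S j b"
  shows "\<exists>c. lie cdim (coeff a) (coeff b) = coeff c \<and> lie_sum S (i + j) c"
  using assms(1)
proof (induction rule: lie_sum.induct)
  case (hom m a)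
  show ?case
    using assms(2)
  proof (induction rule: lie_sum.induct)
    case (hom n b)
    then show ?case
      using \<open>lie_hom S i m a\<close> coeff_brk[OF lie_hom_hdeg lie_hom_hdeg] lie_hom.brk lie_sum.hom by metis
  next
    case (add b b')
    then show ?case by (metis coeff_add lie_bilinear(2) lie_sum.add)
  qed
next
  case (add a a')
  then show ?case by (metis coeff_add lie_bilinear(1) lie_sum.add)
qed

lemma lie_len_lie_sum: "lie_len cdim S k x \<Longrightarrow> \<exists>a. x = coeff a \<and> lie_sum S k a"
proof (induction rule: lie_len.induct)
  case (ll_gen e)
  then show ?case by (metis coeff_gen lie_hom.gen lie_sum.hom)
next
  case (ll_zero k)
  show ?case by (metis coeff_zero lie_hom.zero lie_sum.hom)
next
  case (ll_add k a b)
  then show ?case by (metis coeff_add lie_sum.add)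
next
  case (ll_smult k a q)
  then show ?case by (metis coeff_scal lie_sum_scal)
next
  case (ll_lie i a j b)
  then show ?case using lie_sum_lie by blast
qed

text \<open>Projection to degree \<open>n\<close> fixes or kills each homogeneous summand, so it
  stays within Lie elements; on \<open>a\<close> it is the identity.\<close>

lemma lie_sum_homogeneous:
  assumes "lie_sum S k a" "a \<in> hdeg n"
  shows "lie_hom S k n a"
proof -
  define pr where "pr = lin (\<lambda>u. if deg u = n then mon u else 0)"
  have pr_hom: "pr b = (if m = n then b else 0)" if "b \<in> hdeg m" for b m
    by (rule spn_eqI[OF that]) (auto simp: pr_def is_linear_def is_linearD[OF is_linear_lin])
  have "lie_hom S k n (pr a)"
    using assms(1)
  proof (induction rule: lie_sum.induct)
    case (hom m b)
    then show ?case by (auto simp: pr_hom[OF lie_hom_hdeg] lie_hom.zero)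
  next
    case (add b b')
    then show ?case by (simp add: pr_def is_linearD[OF is_linear_lin] lie_hom.add)
  qed
  with pr_hom[OF assms(2)] show ?thesis by simp
qed

text \<open>The definition states bracket length and degree separately; the forward direction needs
  that a Lie element supported in one degree can be built from brackets homogeneous
  throughout.\<close>

lemma local_deg_minus1_iff:
  "local_deg_minus1 cdim cl k phi \<longleftrightarrow> (\<exists>\<Phi>. phi = (\<lambda>e. coeff (\<Phi> e)) \<and> local_lie cl k \<Phi>)"
proof
  assume L: "local_deg_minus1 cdim cl k phi"
  have "\<exists>a. phi e = coeff a \<and> lie_hom (cl e) k (int (cdim e) - 2) a" for e
  proof -
    obtain a where a: "phi e = coeff a" "lie_sum (cl e) k a"
      using L lie_len_lie_sum by (fastforce simp: local_deg_minus1_def)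
    moreover have "a \<in> hdeg (int (cdim e) - 2)"
      using L a(1) by (auto simp: spn_def in_keys_iff local_deg_minus1_def)
    ultimately show ?thesis using lie_sum_homogeneous by blast
  qed
  then obtain \<Phi> where "\<And>e. phi e = coeff (\<Phi> e) \<and> lie_hom (cl e) k (int (cdim e) - 2) (\<Phi> e)"
    by metis
  then show "\<exists>\<Phi>. phi = (\<lambda>e. coeff (\<Phi> e)) \<and> local_lie cl k \<Phi>"
    by (auto simp: local_lie_def)
next
  assume "\<exists>\<Phi>. phi = (\<lambda>e. coeff (\<Phi> e)) \<and> local_lie cl k \<Phi>"
  then obtain \<Phi> where phi: "phi = (\<lambda>e. coeff (\<Phi> e))" and "local_lie cl k \<Phi>" by blast
  then have lie: "lie_hom (cl e) k (int (cdim e) - 2) (\<Phi> e)" for e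
    by (simp add: local_lie_def)
  show "local_deg_minus1 cdim cl k phi"
    using lie_hom_lie_len[OF lie] lie_hom_hdeg[OF lie]
    by (simp add: local_deg_minus1_def phi spn_def subset_iff in_keys_iff)
qed

text \<open>Elements of \<open>lie_gen\<close> are bare coefficient functions. Finite support is
  what lets them be represented in \<open>'c ta\<close>, where \<open>der\<close> becomes
  \<open>D\<close>.\<close>

lemma lie_finite_support: "\<exists>c. lie cdim (coeff a) (coeff b) = coeff c"
proof -
  have add_ex: "\<exists>c. tadd (coeff a) (coeff b) = coeff c" for a b :: "'c ta"
    by (rule exI) (rule coeff_add[symmetric])
  have scal_ex: "\<exists>c. tsmult q (coeff a) = coeff c" for q and a :: "'c ta"
    by (rule exI) (rule coeff_scal[symmetric])
  have *: "\<exists>c. lie cdim (coeff (mon u)) (coeff b) = coeff c" for u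
  proof (rule ta_span_induct[of b UNIV])
    show "\<exists>c. lie cdim (coeff (mon u)) (coeff (mon v)) = coeff c" for v
      using coeff_brk[OF hdeg_mon hdeg_mon, of u v, symmetric] by blast
    show "\<exists>c. lie cdim (coeff (mon u)) (coeff 0) = coeff c"
      unfolding coeff_zero lie_bilinear by (rule exI, rule coeff_zero[symmetric])
  qed (auto simp: coeff_add lie_bilinear coeff_scal add_ex scal_ex)
  show ?thesis
  proof (rule ta_span_induct[of a UNIV])
    show "\<exists>c. lie cdim (coeff 0) (coeff b) = coeff c"
      unfolding coeff_zero lie_bilinear by (rule exI, rule coeff_zero[symmetric])
  qed (use * in \<open>auto simp: coeff_add lie_bilinear coeff_scal add_ex scal_ex\<close>)
qed

lemma lie_gen_finite_support: "x \<in> lie_gen cdim S \<Longrightarrow> \<exists>a. x = coeff a"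
proof (induction rule: lie_gen.induct)
  case (lg_gen e)
  show ?case by (metis coeff_gen)
next
  case (lg_add a b)
  then show ?case by (metis coeff_add)
next
  case (lg_smult a q)
  then show ?case by (metis coeff_scal)
next
  case (lg_lie a b)
  then show ?case using lie_finite_support by metis
qed

section \<open>Cellular chains\<close>

text \<open>Chains are tensors of word length 1; dimension n becomes degree n - 1.\<close>

definition chain_ta :: "'c set \<Rightarrow> ('c \<Rightarrow> rat) \<Rightarrow> 'c ta" where
  "chain_ta S c = (\<Sum>f\<in>S. scal (c f) * mon [f])"

lemma coeff_chain_ta:
  assumes "finite S"
  shows "coeff (chain_ta S c) [f] = (if f \<in> S then c f else 0)"
proof -
  have "coeff (chain_ta S c) [f] = (\<Sum>g\<in>S. if g = f then c g else 0)"
    by (auto simp: chain_ta_def lookup_sum lookup_single when_def intro!: sum.cong)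
  with assms show ?thesis by simp
qed

lemma chain_ta_tens_on:
  assumes "chain_on cdim S n c"
  shows "chain_ta S c \<in> tens_on S 1 (int n - 1)"
  unfolding chain_ta_def
proof (rule spn_sum)
  fix f assume "f \<in> S"
  then show "scal (c f) * mon [f] \<in> tens_on S 1 (int n - 1)"
    using assms tens_on_gen[of f S "int n - 1"]
    by (cases "c f = 0") (auto simp: chain_on_def intro: spn_scal)
qed

lemma tens_on_chain_ta:
  assumes "finite S" "a \<in> tens_on S 1 (int n - 1)"
  shows "\<exists>c. chain_on cdim S n c \<and> a = chain_ta S c"
  using assms(2)
proof (induction rule: spn_induct)
  case (mon u)
  then obtain f where f: "u = [f]" "f \<in> S" "cdim f = n"
    by (auto elim!: words_1_E[unfolded One_nat_def])
  have "(\<Sum>g\<in>S. scal (if g = f then 1 else 0) * mon [g]) = (\<Sum>g\<in>S. if g = f then mon [g] else 0)"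
    by (intro sum.cong) auto
  with f assms(1) have "mon u = chain_ta S (\<lambda>g. if g = f then 1 else 0)"
    by (simp add: chain_ta_def)
  moreover have "chain_on cdim S n (\<lambda>g. if g = f then 1 else 0)"
    using f by (simp add: chain_on_def)
  ultimately show ?case by blast
next
  case zero
  have "chain_on cdim S n (\<lambda>_. 0)" "0 = chain_ta S (\<lambda>_. 0)"
    by (simp_all add: chain_on_def chain_ta_def)
  then show ?case by blast
next
  case (add a b)
  then obtain c d where "chain_on cdim S n c" "a = chain_ta S c" "chain_on cdim S n d" "b = chain_ta S d"
    by blast
  then have "chain_on cdim S n (\<lambda>g. c g + d g)" "a + b = chain_ta S (\<lambda>g. c g + d g)"
    by (auto simp: chain_on_def chain_ta_def scal_add distrib_right sum.distrib)
       (metis add.right_neutral)+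
  then show ?case by blast
next
  case (scal q a)
  then obtain c where "chain_on cdim S n c" "a = chain_ta S c"
    by blast
  then have "chain_on cdim S n (\<lambda>g. q * c g)" "scal q * a = chain_ta S (\<lambda>g. q * c g)"
    by (auto simp: chain_on_def chain_ta_def scal_mult sum_distrib_left mult.assoc)
  then show ?case by blast
qed

lemma chain_ta_inj:
  assumes "finite S" "\<And>f. c f \<noteq> 0 \<Longrightarrow> f \<in> S" "\<And>f. d f \<noteq> 0 \<Longrightarrow> f \<in> S" "chain_ta S c = chain_ta S d"
  shows "c = d"
proof
  fix f
  show "c f = d f"
    using coeff_chain_ta[OF assms(1), of c f] coeff_chain_ta[OF assms(1), of d f] assms(2-3)[of f] assms(4)
    by (metis (full_types))
qed

definition cell_bd :: "('c \<Rightarrow> 'c set) \<Rightarrow> ('c \<Rightarrow> 'c \<Rightarrow> int) \<Rightarrow> 'c \<Rightarrow> 'c ta" where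
  "cell_bd cl bd e = chain_ta (cl e) (\<lambda>f. of_int (bd e f))"

lemma coeff_cell_bd: "coeff (cell_bd cl bd e) = cell_delta cl bd e"
  by (simp add: fun_eq_iff cell_bd_def chain_ta_def cell_delta_def lookup_sum coeff_gen)

context
  fixes cl bd
  assumes cx: "cell_complex cdim cl bd"
begin

lemma cell_complexD:
  shows "finite (cl e)" "e \<in> cl e" "f \<in> cl e \<Longrightarrow> cl f \<subseteq> cl e"
    "bd e f \<noteq> 0 \<Longrightarrow> f \<in> cl e" "bd e f \<noteq> 0 \<Longrightarrow> cdim f + 1 = cdim e"
    "(\<Sum>f\<in>cl e. bd e f * bd f g) = 0"
  using cx unfolding cell_complex_def by blast+

lemma cell_bd_tens_on: "cell_bd cl bd e \<in> tens_on (cl e) 1 (int (cdim e) - 2)"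
  unfolding cell_bd_def chain_ta_def
proof (rule spn_sum)
  fix f assume "f \<in> cl e"
  then show "scal (of_int (bd e f)) * mon [f] \<in> tens_on (cl e) 1 (int (cdim e) - 2)"
    using cell_complexD(5)[of e f] tens_on_gen[of f "cl e" "int (cdim e) - 2"]
    by (cases "bd e f = 0") (auto intro!: spn_scal)
qed

lemma local_lie_cell_bd: "local_lie cl 1 (cell_bd cl bd)"
  using tens_on_1_lie_hom[OF cell_bd_tens_on] by (simp add: local_lie_def)

lemma D_chain_ta:
  "D (cell_bd cl bd) (chain_ta (cl e) c) = chain_ta (cl e) (chain_bd bd (cl e) c)"
proof -
  \<comment> \<open>Incidence numbers vanish outside the closure of \<open>f\<close>, so all faces
    can be summed over the common set \<open>cl e\<close> and the double sum can be
    interchanged.\<close>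
  have "cell_bd cl bd f = (\<Sum>g\<in>cl e. scal (of_int (bd f g)) * mon [g])" if "f \<in> cl e" for f
    unfolding cell_bd_def chain_ta_def
  proof (rule sum.mono_neutral_left)
    have "bd f g = 0" if "g \<notin> cl f" for g
      using cell_complexD(4) that by blast
    then show "\<forall>g\<in>cl e - cl f. scal (of_int (bd f g)) * mon [g] = 0"
      by simp
  qed (use cell_complexD that in auto)
  then have "D (cell_bd cl bd) (chain_ta (cl e) c)
      = (\<Sum>f\<in>cl e. \<Sum>g\<in>cl e. scal (c f * of_int (bd f g)) * mon [g])"
    by (simp add: chain_ta_def[of _ c] D_linear D_gen sum_distrib_left scal_mult mult.assoc)
  also have "\<dots> = (\<Sum>g\<in>cl e. \<Sum>f\<in>cl e. scal (c f * of_int (bd f g)) * mon [g])"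
    by (rule sum.swap)
  also have "\<dots> = chain_ta (cl e) (chain_bd bd (cl e) c)"
  proof -
    have "scal (\<Sum>f\<in>F. r f) = (\<Sum>f\<in>F. scal (r f) :: 'c ta)" for r :: "'c \<Rightarrow> rat" and F
      by (induction F rule: infinite_finite_induct) (simp_all add: scal_add)
    then show ?thesis
      by (simp add: chain_ta_def chain_bd_def sum_distrib_right)
  qed
  finally show ?thesis .
qed

lemma chain_bd_support: "chain_bd bd (cl e) c f \<noteq> 0 \<Longrightarrow> f \<in> cl e"
proof (rule ccontr)
  assume "chain_bd bd (cl e) c f \<noteq> 0" "f \<notin> cl e"
  moreover have "bd g f = 0" if "g \<in> cl e" for g
    using cell_complexD(3,4) that \<open>f \<notin> cl e\<close> by blast
  ultimately show False by (simp add: chain_bd_def)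
qed

lemma D_cell_bd: "D (cell_bd cl bd) (cell_bd cl bd e) = 0"
proof -
  have "chain_bd bd (cl e) (\<lambda>f. of_int (bd e f)) = (\<lambda>_. 0)"
    using cell_complexD(6)[of e] by (simp add: chain_bd_def fun_eq_iff flip: of_int_mult of_int_sum)
  then show ?thesis
    using D_chain_ta[of e "\<lambda>f. of_int (bd e f)"]
    by (simp add: cell_bd_def[of cl bd e, symmetric]) (simp add: chain_ta_def)
qed

lemma closure_lie_acyclic:
  assumes pt: "rat_homology_point cdim bd (cl e)"
    and z: "lie_hom (cl e) k n z" "D (cell_bd cl bd) z = 0" and k: "k \<ge> 3"
  shows "\<exists>w. lie_hom (cl e) k (n + 1) w \<and> D (cell_bd cl bd) w = z"
proof -
  let ?S = "cl e" and ?d = "D (cell_bd cl bd)"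
  obtain z0 where z0: "chain_on cdim ?S 0 z0" "\<not> (\<exists>w. chain_on cdim ?S 1 w \<and> chain_bd bd ?S w = z0)"
    "\<And>z. chain_on cdim ?S 0 z \<Longrightarrow> \<exists>q w. chain_on cdim ?S 1 w \<and> z = (\<lambda>f. q * z0 f + chain_bd bd ?S w f)"
    using pt unfolding rat_homology_point_def by blast
  have fin: "finite ?S" by (rule cell_complexD)
  show ?thesis
  proof (rule lie_hom_acyclic[where x = "chain_ta ?S z0" and S = ?S])
    show "cell_bd cl bd f \<in> tens_on ?S 1 (int (cdim f) - 2)" if "f \<in> ?S" for f
      using cell_bd_tens_on[of f] cell_complexD(3)[OF that] by (auto elim!: spn_mono simp: words_def)
    show "cell_bd cl bd f \<in> tens_on UNIV 1 (int (cdim f) - 2)" for f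
      using cell_bd_tens_on[of f] by (auto elim!: spn_mono simp: words_def)
    show "chain_ta ?S z0 \<in> tens_on ?S 1 (- 1)"
      using chain_ta_tens_on[OF z0(1)] by simp
    show "\<exists>w\<in>tens_on ?S 1 (n + 1). ?d w = z" if n: "n \<ge> 0" and z: "z \<in> tens_on ?S 1 n" "?d z = 0" for n z
    proof -
      \<comment> \<open>The dimension belonging to tensor degree \<open>n\<close>; it is at least 1,
        as the higher homology condition requires.\<close>
      define N where "N = nat n + 1"
      have N: "n = int N - 1" "N \<ge> 1" using n by (simp_all add: N_def)
      obtain c where c: "chain_on cdim ?S N c" "z = chain_ta ?S c"
        using tens_on_chain_ta[OF fin] z(1) N by metis
      have "chain_ta ?S (chain_bd bd ?S c) = chain_ta ?S (\<lambda>_. 0)"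
        using z(2) by (simp add: c D_chain_ta) (simp add: chain_ta_def)
      then have "chain_bd bd ?S c = (\<lambda>_. 0)"
        by (rule chain_ta_inj[OF fin chain_bd_support, rotated -1]) auto
      then obtain w where "chain_on cdim ?S (N + 1) w" "chain_bd bd ?S w = c"
        using pt c(1) N(2) unfolding rat_homology_point_def by blast
      then show ?thesis
        using chain_ta_tens_on[of ?S "N + 1" w] N
        by (intro bexI[of _ "chain_ta ?S w"]) (simp_all add: D_chain_ta c)
    qed
    show "\<not> (\<exists>w\<in>tens_on ?S 1 0. ?d w = chain_ta ?S z0)"
    proof
      assume "\<exists>w\<in>tens_on ?S 1 0. ?d w = chain_ta ?S z0"
      then obtain w where "w \<in> tens_on ?S 1 (int 1 - 1)" "?d w = chain_ta ?S z0" by auto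
      then obtain c where c: "chain_on cdim ?S 1 c" "chain_ta ?S (chain_bd bd ?S c) = chain_ta ?S z0"
        using tens_on_chain_ta[OF fin] by (metis D_chain_ta)
      from c(2) have "chain_bd bd ?S c = z0"
        using z0(1) by (intro chain_ta_inj[OF fin chain_bd_support _ c(2)]) (auto simp: chain_on_def)
      with c(1) z0(2) show False by blast
    qed
    show "\<exists>q. \<exists>w\<in>tens_on ?S 1 0. z = scal q * chain_ta ?S z0 + ?d w" if z: "z \<in> tens_on ?S 1 (- 1)" for z
    proof -
      obtain c where c: "chain_on cdim ?S 0 c" "z = chain_ta ?S c"
        using tens_on_chain_ta[OF fin, of z 0] z by auto
      obtain q w where w: "chain_on cdim ?S 1 w" "c = (\<lambda>f. q * z0 f + chain_bd bd ?S w f)"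
        using z0(3)[OF c(1)] by blast
      have "z = scal q * chain_ta ?S z0 + ?d (chain_ta ?S w)"
        unfolding D_chain_ta
        by (simp add: c(2) w(2) chain_ta_def scal_add scal_mult distrib_right sum.distrib sum_distrib_left mult.assoc)
      moreover have "chain_ta ?S w \<in> tens_on ?S 1 0"
        using chain_ta_tens_on[OF w(1)] by simp
      ultimately show ?thesis by blast
    qed
  qed (use D_cell_bd z k in auto)
qed

end

end

theorem mainTheorem8:
  fixes cdim :: "'c \<Rightarrow> nat" and ccl :: "'c \<Rightarrow> 'c set" and cbd :: "'c \<Rightarrow> 'c \<Rightarrow> int"
    and delta2 :: "'c \<Rightarrow> 'c list \<Rightarrow> rat"
  assumes cx: "cell_complex cdim ccl cbd"
    and acyc: "\<forall>e. rat_homology_point cdim cbd (ccl e)"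
    and d2: "local_deg_minus1 cdim ccl 2 delta2"
    and comm: "\<forall>x\<in>lie_gen cdim UNIV.
       tadd (der cdim (cell_delta ccl cbd) (der cdim delta2 x))
            (der cdim delta2 (der cdim (cell_delta ccl cbd) x)) = (\<lambda>_. 0)"
  shows "\<exists>delta :: nat \<Rightarrow> 'c \<Rightarrow> 'c list \<Rightarrow> rat.
     delta 1 = cell_delta ccl cbd \<and> delta 2 = delta2 \<and>
     (\<forall>k\<ge>3. local_deg_minus1 cdim ccl k (delta k)) \<and>
     (\<forall>m\<ge>2. \<forall>x\<in>lie_gen cdim UNIV.
        (\<lambda>w. \<Sum>i\<in>{1..m-1}. der cdim (delta i) (der cdim (delta (m - i)) x) w) = (\<lambda>_. 0))"
proof -
  interpret graded_cells cdim .
  let ?\<Phi> = "cell_bd ccl cbd"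
  have \<Phi>: "cell_delta ccl cbd = (\<lambda>e. coeff (?\<Phi> e))"
    by (simp add: fun_eq_iff coeff_cell_bd)
  obtain \<delta>2 where \<delta>2: "delta2 = (\<lambda>e. coeff (\<delta>2 e))" "local_lie ccl 2 \<delta>2"
    using d2 local_deg_minus1_iff by blast
  have comm': "D ?\<Phi> (\<delta>2 e) + D \<delta>2 (?\<Phi> e) = 0" for e
  proof -
    \<comment> \<open>The hypothesis is stated on the whole Lie algebra; its values on generators
      are what the construction consumes.\<close>
    have "gen e \<in> lie_gen cdim UNIV" by (simp add: lie_gen.lg_gen)
    with comm have "coeff (D ?\<Phi> (D \<delta>2 (mon [e])) + D \<delta>2 (D ?\<Phi> (mon [e]))) = (\<lambda>_. 0)"
      unfolding coeff_add coeff_D \<Phi>[symmetric] \<delta>2(1)[symmetric] coeff_gen by blast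
    then show ?thesis
      by (intro poly_mapping_eqI) (simp add: D_gen)
  qed
  have "\<exists>\<delta>. \<delta> 1 = ?\<Phi> \<and> \<delta> 2 = \<delta>2 \<and> (\<forall>k\<ge>3. local_lie ccl k (\<delta> k)) \<and> (\<forall>m a. obs \<delta> m a = 0)"
  proof (rule extend_all)
    show "\<exists>w. lie_hom (ccl e) k (n + 1) w \<and> D ?\<Phi> w = z"
      if "k \<ge> 3" "lie_hom (ccl e) k n z" "D ?\<Phi> z = 0" for e k n z
      using closure_lie_acyclic[OF cx] acyc that by blast
  qed (use cell_complexD[OF cx] local_lie_cell_bd[OF cx] \<delta>2(2) D_cell_bd[OF cx] comm' in auto)
  then obtain \<delta> where \<delta>: "\<delta> 1 = ?\<Phi>" "\<delta> 2 = \<delta>2" "\<And>k. k \<ge> 3 \<Longrightarrow> local_lie ccl k (\<delta> k)"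
    "\<And>m a. obs \<delta> m a = 0" by blast
  let ?delta = "\<lambda>k e. coeff (\<delta> k e)"
  have "(\<lambda>w. \<Sum>i\<in>{1..m-1}. der cdim (?delta i) (der cdim (?delta (m - i)) x) w) = (\<lambda>_. 0)"
    if "x \<in> lie_gen cdim UNIV" for m x
  proof -
    obtain a where "x = coeff a"
      using \<open>x \<in> lie_gen cdim UNIV\<close> lie_gen_finite_support by blast
    then have "(\<lambda>w. \<Sum>i\<in>{1..m-1}. der cdim (?delta i) (der cdim (?delta (m - i)) x) w) = coeff (obs \<delta> m a)"
      by (intro ext) (simp add: obs_def lookup_sum coeff_D)
    then show ?thesis by (simp add: \<delta>(4) coeff_zero)
  qed
  moreover have "local_deg_minus1 cdim ccl k (?delta k)" if "k \<ge> 3" for k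
    using \<delta>(3)[OF that] local_deg_minus1_iff by blast
  ultimately show ?thesis
    using \<delta>(1,2) by (intro exI[of _ ?delta]) (simp add: \<Phi> \<delta>2(1))
qed

end
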